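(* Let $G=(V,E)$ be a finite graph. For $r\in\mathbb{N}\cup\{\infty,*\}$ we have $\xi_r^{\mathrm{col}}(G)\le\gamma_r^{\mathrm{col}}(G)$ and $\xi_r^{\mathrm{stab}}(G)\ge\gamma_r^{\mathrm{stab}}(G)$.
   Context: $[k]=\{1,\dots,k\}$. For a finite set $\mathbf{x}$ of noncommuting variables and $m\in\mathbb{N}\cup\{\infty\}$, $\mathbb{R}\langle\mathbf{x}\rangle_m$ is the space of real noncommutative polynomials of degree at most $m$ (all polynomials if $m=\infty$), with involution $*$ reversing words and fixing the variables. For $r\in\mathbb{N}\cup\{\infty\}$, a linear functional $L\in\mathbb{R}\langle\mathbf{x}\rangle_{2r}^*$ is symmetric if $L(w)=L(w^* )$ for all words $w$ of degree at most $2r$, tracial if $L(ww')=L(w'w)$ for all words with $\deg(ww')\le2r$, and positive if $L(p^*p)\ge0$ for all $p$ of degree at most $r$. For $r=\infty$, $M(L)=(L(w^*w'))$ is the moment matrix indexed by all words. For a set $\mathcal{H}$ of polynomials, $\mathcal{I}_{2r}(\mathcal{H})=\{ph:p\in\mathbb{R}\langle\mathbf{x}\rangle,h\in\mathcal{H},\deg(ph)\le2r\}$. For $r=\infty$ there are no degree restrictions. With variables $\mathbf{x}=(x_i:i\in V)$, let $\mathcal{H}_G=\{x_i-x_i^2:i\in V\}\cup\{x_ix_j:\{i,j\}\in E\}$, and for $r\in\mathbb{N}\cup\{\infty\}$ let $$\xi_r^{\mathrm{stab}}(G)=\sup\Big\{L\Big(\sum_{i\in V}x_i\Big):L\in\mathbb{R}\langle\mathbf{x}\rangle_{2r}^*\text{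 tracial, symmetric, positive},\ L(1)=1,\ L=0\text{ on }\mathcal{I}_{2r}(\mathcal{H}_G)\Big\},$$ $$\xi_r^{\mathrm{col}}(G)=\inf\big\{L(1):L\in\mathbb{R}\langle\mathbf{x}\rangle_{2r}^*\text{ tracial, symmetric, positive},\ L(x_i)=1\ (i\in V),\ L=0\text{ on }\mathcal{I}_{2r}(\mathcal{H}_G)\big\}.$$ Write $i\simeq j$ if $i=j$ or $\{i,j\}\in E$, and let $$\mathcal{H}^{\mathrm{col}}_{G,k}=\Big\{1-\sum_{c\in[k]}x_i^c:i\in V\Big\}\cup\{x_i^cx_j^{c'}:(c\ne c'\text{ and }i=j)\text{ or }(c=c'\text{ and }\{i,j\}\in E)\},$$ $$\mathcal{H}^{\mathrm{stab}}_{G,k}=\Big\{1-\sum_{i\in V}x_c^i:c\in[k]\Big\}\cup\{x_c^ix_{c'}^j:(i\ne j\text{ and }c=c')\text{ or }(i\simeq j\text{ and }c\ne c')\}.$$ For $r\in\mathbb{N}\cup\{\infty\}$, $\gamma_r^{\mathrm{col}}(G)$ is the smallest $k\in\mathbb{N}$ for which there is a symmetric, tracial, positive $L\in\mathbb{R}\langle\{x_i^c:i\in V,c\in[k]\}\rangle_{2r}^*$ with $L(1)=1$ and $L=0$ on $\mathcal{I}_{2r}(\mathcal{H}^{\mathrm{col}}_{G,k})$; $\gamma_r^{\mathrm{stab}}(G)$ is the largest $k\in\mathbb{N}$ for which there is a symmetric, tracial, positive $L\in\mathbb{R}\langle\{x_c^i:c\in[k],i\in V\}\rangle_{2r}^*$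 with $L(1)=1$ and $L=0$ on $\mathcal{I}_{2r}(\mathcal{H}^{\mathrm{stab}}_{G,k})$. For each of the four parameters, the version with subscript $*$ is obtained from the version with subscript $\infty$ by adding the constraint $\operatorname{rank}(M(L))<\infty$ on $L$. *)

theory Defs
  imports Complex_Main "HOL-Library.Poly_Mapping" "HOL-Library.Extended_Real"
begin

text \<open>
  Words are lists, made into the free monoid under concatenation, so that finitely supported
  maps from words to reals form the free algebra: the product of \<open>Poly_Mapping\<close> is convolution.
\<close>

instantiation list :: (type) monoid_add
begin

definition zero_list :: "'a list" where "zero_list = []"

definition plus_list :: "'a list \<Rightarrow> 'a list \<Rightarrow> 'a list" where "plus_list u w = u @ w"

instance
  by standard (simp_all add: zero_list_def plus_list_def)

end

type_synonym 'a ncpoly = "'a list \<Rightarrow>\<^sub>0 real"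

definition ncword :: "'a list \<Rightarrow> 'a ncpoly" where
  "ncword w = Poly_Mapping.single w 1"

definition ncvar :: "'a \<Rightarrow> 'a ncpoly" where
  "ncvar x = ncword [x]"

definition ncscale :: "real \<Rightarrow> 'a ncpoly \<Rightarrow> 'a ncpoly" where
  "ncscale a p = Poly_Mapping.single [] a * p"

text \<open>The coefficient of \<open>w\<close> in \<open>ncstar p\<close> is the coefficient of \<open>rev w\<close> in \<open>p\<close>.\<close>

definition ncstar :: "'a ncpoly \<Rightarrow> 'a ncpoly" where
  "ncstar p = Poly_Mapping.map_key rev p"

text \<open>The zero polynomial gets degree 0.\<close>

definition ncdeg :: "'a ncpoly \<Rightarrow> nat" where
  "ncdeg p = Max (insert 0 (length ` Poly_Mapping.keys p))"

definition ncpolys :: "'a set \<Rightarrow> enat \<Rightarrow> 'a ncpoly set" where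
  "ncpolys X m = {p. Poly_Mapping.keys p \<subseteq> lists X \<and> enat (ncdeg p) \<le> m}"

text \<open>
  A functional on \<open>ncpolys X d\<close> is represented by a total function of which only the values
  on \<open>ncpolys X d\<close> are constrained.
\<close>

definition linear_functional :: "'a set \<Rightarrow> enat \<Rightarrow> ('a ncpoly \<Rightarrow> real) \<Rightarrow> bool" where
  "linear_functional X d L \<longleftrightarrow>
     (\<forall>p\<in>ncpolys X d. \<forall>q\<in>ncpolys X d. L (p + q) = L p + L q) \<and>
     (\<forall>p\<in>ncpolys X d. \<forall>a. L (ncscale a p) = a * L p)"

definition symmetric :: "'a set \<Rightarrow> enat \<Rightarrow> ('a ncpoly \<Rightarrow> real) \<Rightarrow> bool" where
  "symmetric X d L \<longleftrightarrow>
     (\<forall>w\<in>lists X. enat (length w) \<le> d \<longrightarrow> L (ncword w) = L (ncword (rev w)))"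

definition tracial :: "'a set \<Rightarrow> enat \<Rightarrow> ('a ncpoly \<Rightarrow> real) \<Rightarrow> bool" where
  "tracial X d L \<longleftrightarrow>
     (\<forall>u\<in>lists X. \<forall>w\<in>lists X. enat (length (u @ w)) \<le> d \<longrightarrow>
        L (ncword (u @ w)) = L (ncword (w @ u)))"

definition positive :: "'a set \<Rightarrow> enat \<Rightarrow> ('a ncpoly \<Rightarrow> real) \<Rightarrow> bool" where
  "positive X r L \<longleftrightarrow> (\<forall>p\<in>ncpolys X r. L (ncstar p * p) \<ge> 0)"

definition trunc_ideal :: "'a set \<Rightarrow> enat \<Rightarrow> 'a ncpoly set \<Rightarrow> 'a ncpoly set" where
  "trunc_ideal X d H = {p * h | p h. p \<in> ncpolys X \<infinity> \<and> h \<in> H \<and> enat (ncdeg (p * h)) \<le> d}"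

text \<open>
  Rank of a possibly infinite matrix, with rows indexed by \<open>I\<close> and columns by \<open>J\<close>:
  the maximal number of linearly independent columns, or \<open>\<infinity>\<close> if there is no maximum.
\<close>

definition indep_columns :: "'i set \<Rightarrow> ('i \<Rightarrow> 'j \<Rightarrow> real) \<Rightarrow> 'j set \<Rightarrow> bool" where
  "indep_columns I M S \<longleftrightarrow>
     (\<forall>a. (\<forall>i\<in>I. (\<Sum>j\<in>S. a j * M i j) = 0) \<longrightarrow> (\<forall>j\<in>S. a j = 0))"

definition matrix_rank :: "'i set \<Rightarrow> 'j set \<Rightarrow> ('i \<Rightarrow> 'j \<Rightarrow> real) \<Rightarrow> enat" where
  "matrix_rank I J M = Sup {enat (card S) | S. finite S \<and> S \<subseteq> J \<and> indep_columns I M S}"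

definition moment_matrix :: "('a ncpoly \<Rightarrow> real) \<Rightarrow> 'a list \<Rightarrow> 'a list \<Rightarrow> real" where
  "moment_matrix L u w = L (ncword (rev u @ w))"

text \<open>
  The subscripts of the parameters: \<open>Level (enat n)\<close> is \<open>n\<close>, \<open>Level \<infinity>\<close> is \<open>\<infinity>\<close>, and
  \<open>Star\<close> is \<open>*\<close>.
\<close>

datatype level = Level enat | Star

primrec level_bound :: "level \<Rightarrow> enat" where
  "level_bound (Level r) = r"
| "level_bound Star = \<infinity>"

definition admissible :: "'a set \<Rightarrow> level \<Rightarrow> 'a ncpoly set \<Rightarrow> ('a ncpoly \<Rightarrow> real) \<Rightarrow> bool" where
  "admissible X r H L \<longleftrightarrow>
     linear_functional X (2 * level_bound r) L \<and>
     symmetric X (2 * level_bound r) L \<and>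
     tracial X (2 * level_bound r) L \<and>
     positive X (level_bound r) L \<and>
     (\<forall>f\<in>trunc_ideal X (2 * level_bound r) H. L f = 0) \<and>
     (r = Star \<longrightarrow> matrix_rank (lists X) (lists X) (moment_matrix L) < \<infinity>)"

definition H_graph :: "'v set \<Rightarrow> 'v set set \<Rightarrow> 'v ncpoly set" where
  "H_graph V E =
     {ncvar i - ncvar i ^ 2 | i. i \<in> V} \<union>
     {ncvar i * ncvar j | i j. {i, j} \<in> E}"

text \<open>
  The number \<open>\<xi>\<^sub>0\<close> has no meaning of its own, as \<open>x\<^sub>i\<close> does not lie in the space of polynomials
  of degree 0; below, \<open>L (ncvar i)\<close> is then unconstrained by admissibility.
\<close>

definition xi_stab :: "level \<Rightarrow> 'v set \<Rightarrow> 'v set set \<Rightarrow> ereal" where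
  "xi_stab r V E =
     Sup {ereal (L (\<Sum>i\<in>V. ncvar i)) | L. admissible V r (H_graph V E) L \<and> L 1 = 1}"

definition xi_col :: "level \<Rightarrow> 'v set \<Rightarrow> 'v set set \<Rightarrow> ereal" where
  "xi_col r V E =
     Inf {ereal (L 1) | L. admissible V r (H_graph V E) L \<and> (\<forall>i\<in>V. L (ncvar i) = 1)}"

text \<open>The variable \<open>x\<^sub>i\<^sup>c\<close> is indexed by \<open>(i, c)\<close>.\<close>

definition H_col :: "'v set \<Rightarrow> 'v set set \<Rightarrow> nat \<Rightarrow> ('v \<times> nat) ncpoly set" where
  "H_col V E k =
     {1 - (\<Sum>c\<in>{1..k}. ncvar (i, c)) | i. i \<in> V} \<union>
     {ncvar (i, c) * ncvar (j, c') | i c j c'.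
        i \<in> V \<and> j \<in> V \<and> c \<in> {1..k} \<and> c' \<in> {1..k} \<and>
        ((c \<noteq> c' \<and> i = j) \<or> (c = c' \<and> {i, j} \<in> E))}"

text \<open>The variable \<open>x\<^sub>c\<^sup>i\<close> is indexed by \<open>(c, i)\<close>.\<close>

definition H_stab :: "'v set \<Rightarrow> 'v set set \<Rightarrow> nat \<Rightarrow> (nat \<times> 'v) ncpoly set" where
  "H_stab V E k =
     {1 - (\<Sum>i\<in>V. ncvar (c, i)) | c. c \<in> {1..k}} \<union>
     {ncvar (c, i) * ncvar (c', j) | c i c' j.
        i \<in> V \<and> j \<in> V \<and> c \<in> {1..k} \<and> c' \<in> {1..k} \<and>
        ((i \<noteq> j \<and> c = c') \<or> ((i = j \<or> {i, j} \<in> E) \<and> c \<noteq> c'))}"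

definition gamma_col :: "level \<Rightarrow> 'v set \<Rightarrow> 'v set set \<Rightarrow> nat" where
  "gamma_col r V E =
     (LEAST k. \<exists>L. admissible (V \<times> {1..k}) r (H_col V E k) L \<and> L 1 = 1)"

definition gamma_stab :: "level \<Rightarrow> 'v set \<Rightarrow> 'v set set \<Rightarrow> nat" where
  "gamma_stab r V E =
     (GREATEST k. \<exists>L. admissible ({1..k} \<times> V) r (H_stab V E k) L \<and> L 1 = 1)"

end

theory Submission
  imports Defs
begin

text \<open>
  A functional composed with a substitution \<open>x \<mapsto> s x\<close> into self-adjoint polynomials of degree at
  most 1 stays linear, symmetric, tracial, positive, and of finite rank. For the colouring parameter,
  add up the pullbacks of an optimal \<open>L\<close> under \<open>x\<^sub>i \<mapsto> x\<^sub>i\<^sup>c\<close> over the colours \<open>c\<close>: the sum has value \<open>k\<close> at 1.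
  For the stability parameter, pull \<open>L\<close> back under \<open>x\<^sub>i \<mapsto> \<Sum>c. x\<^sub>c\<^sup>i\<close>: the pullback has value \<open>k\<close> at \<open>\<Sum>i. x\<^sub>i\<close>.
  In both cases \<open>x\<^sub>i - x\<^sub>i\<^sup>2\<close> is mapped into the truncated ideal because
  \<open>y\<^sub>a - y\<^sub>a\<^sup>2 = y\<^sub>a (1 - (\<Sum>b. y\<^sub>b)) + (\<Sum>b\<noteq>a. y\<^sub>a y\<^sub>b)\<close>.

  The minimum and the maximum have to exist: an injective colouring makes \<open>k = card V\<close> feasible, and
  the pullback satisfies \<open>L x\<^sub>i \<le> 1\<close>, which bounds \<open>k\<close> by \<open>card V\<close> in the stability case.
\<close>

section \<open>The free algebra\<close>

lemma enat_length_append_le: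
  assumes "enat (length u) \<le> m" "enat (length w) \<le> n"
  shows "enat (length (u @ w)) \<le> m + n"
  using add_mono[OF assms] by simp

lemma enat_ncdeg_le_iff: "enat (ncdeg p) \<le> d \<longleftrightarrow> (\<forall>w\<in>Poly_Mapping.keys p. enat (length w) \<le> d)"
  by (cases d) (auto simp: ncdeg_def)

lemma ncpolys_iff:
  "p \<in> ncpolys X d \<longleftrightarrow> (\<forall>w\<in>Poly_Mapping.keys p. w \<in> lists X \<and> enat (length w) \<le> d)"
  by (auto simp: ncpolys_def enat_ncdeg_le_iff)

lemma zero_in_ncpolys: "0 \<in> ncpolys X d"
  by (simp add: ncpolys_iff)

lemma single_in_ncpolys:
  "w \<in> lists X \<Longrightarrow> enat (length w) \<le> d \<Longrightarrow> Poly_Mapping.single w a \<in> ncpolys X d"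
  by (simp add: ncpolys_iff)

lemma ncword_in_ncpolys: "w \<in> lists X \<Longrightarrow> enat (length w) \<le> d \<Longrightarrow> ncword w \<in> ncpolys X d"
  by (simp add: ncword_def single_in_ncpolys)

lemma rev_in_lists: "rev w \<in> lists X \<longleftrightarrow> w \<in> lists X"
  by (simp add: in_lists_conv_set)

lemma one_in_ncpolys: "1 \<in> ncpolys X d"
  by (simp add: ncpolys_iff zero_list_def flip: zero_enat_def)

lemma ncvar_in_ncpolys: "x \<in> X \<Longrightarrow> 1 \<le> d \<Longrightarrow> ncvar x \<in> ncpolys X d"
  by (simp add: ncvar_def ncword_def single_in_ncpolys one_enat_def)

lemma add_in_ncpolys: "p \<in> ncpolys X d \<Longrightarrow> q \<in> ncpolys X d \<Longrightarrow> p + q \<in> ncpolys X d"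
  using keys_add[of p q] by (auto simp: ncpolys_iff)

lemma diff_in_ncpolys: "p \<in> ncpolys X d \<Longrightarrow> q \<in> ncpolys X d \<Longrightarrow> p - q \<in> ncpolys X d"
  using keys_diff[of p q] by (auto simp: ncpolys_iff)

lemma sum_in_ncpolys: "(\<And>i. i \<in> I \<Longrightarrow> f i \<in> ncpolys X d) \<Longrightarrow> sum f I \<in> ncpolys X d"
  by (induction I rule: infinite_finite_induct) (auto intro: add_in_ncpolys zero_in_ncpolys)

lemma mult_in_ncpolys:
  assumes "p \<in> ncpolys X m" "q \<in> ncpolys X n"
  shows "p * q \<in> ncpolys X (m + n)"
  unfolding ncpolys_iff
proof
  fix w assume "w \<in> Poly_Mapping.keys (p * q)"
  then obtain u v where "u \<in> Poly_Mapping.keys p" "v \<in> Poly_Mapping.keys q" "w = u @ v"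
    using keys_mult[of p q] by (auto simp: plus_list_def)
  with assms show "w \<in> lists X \<and> enat (length w) \<le> m + n"
    using enat_length_append_le[of u m v n] by (auto simp: ncpolys_iff)
qed

lemma ncpolys_mono: "p \<in> ncpolys X m \<Longrightarrow> m \<le> n \<Longrightarrow> p \<in> ncpolys X n"
  by (auto simp: ncpolys_iff)

lemma ncpolys_unbounded: "p \<in> ncpolys X d \<Longrightarrow> p \<in> ncpolys X \<infinity>"
  by (simp add: ncpolys_iff)

lemma in_ncpolys_ncdeg: "p \<in> ncpolys X \<infinity> \<Longrightarrow> p \<in> ncpolys X (enat (ncdeg p))"
  by (simp add: ncpolys_def)

lemma single_Nil_1: "Poly_Mapping.single [] 1 = (1 :: 'a ncpoly)"
  by (metis single_one zero_list_def)

lemma ncscale_single: "ncscale a (Poly_Mapping.single w b) = Poly_Mapping.single w (a * b)"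
  by (simp add: ncscale_def mult_single plus_list_def)

lemma ncscale_0: "ncscale 0 p = 0"
  by (simp add: ncscale_def)

lemma ncscale_minus1: "ncscale (- 1) p = - p"
proof -
  have "Poly_Mapping.single [] (- 1) = (- 1 :: 'a ncpoly)"
    using single_uminus[of "[] :: 'a list" "1 :: real"] by (simp add: single_Nil_1)
  then show ?thesis
    by (simp add: ncscale_def)
qed

lemma ncscale_in_ncpolys: "p \<in> ncpolys X d \<Longrightarrow> ncscale a p \<in> ncpolys X d"
  using mult_in_ncpolys[of "Poly_Mapping.single [] a" X 0 p d]
  by (simp add: ncscale_def single_in_ncpolys flip: zero_enat_def)

lemma uminus_in_ncpolys: "p \<in> ncpolys X d \<Longrightarrow> - p \<in> ncpolys X d"
  by (simp add: ncpolys_iff)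

lemma ncword_Nil: "ncword [] = 1"
  by (simp add: ncword_def single_Nil_1)

lemma ncword_append: "ncword (u @ w) = ncword u * ncword w"
  by (simp add: ncword_def mult_single plus_list_def)

text \<open>A polynomial is the sum of its terms, and every partial sum obeys the same restrictions
  on degree and variables. Keeping these restrictions in the cases matters because functionals are
  constrained only on the truncated space.\<close>

lemma ncpolys_induct [consumes 1, case_names single add]:
  assumes "p \<in> ncpolys X d"
    and single: "\<And>w a. w \<in> lists X \<Longrightarrow> enat (length w) \<le> d \<Longrightarrow> P (Poly_Mapping.single w a)"
    and add: "\<And>p q. p \<in> ncpolys X d \<Longrightarrow> q \<in> ncpolys X d \<Longrightarrow> P p \<Longrightarrow> P q \<Longrightarrow> P (p + q)"
  shows "P p"
proof -
  let ?t = "\<lambda>w. Poly_Mapping.single w (Poly_Mapping.lookup p w)"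
  have t: "?t w \<in> ncpolys X d \<and> P (?t w)" if "w \<in> Poly_Mapping.keys p" for w
    using assms(1) that by (auto simp: ncpolys_iff intro: single)
  have "sum ?t S \<in> ncpolys X d \<and> P (sum ?t S)" if "S \<subseteq> Poly_Mapping.keys p" for S
    using finite_subset[OF that finite_keys] that
  proof (induction S rule: finite_induct)
    case empty
    show ?case
      using single[of "[]" 0] by (simp add: zero_in_ncpolys flip: zero_enat_def)
  next
    case (insert w S)
    with t show ?case
      by (auto intro: add add_in_ncpolys)
  qed
  moreover have "p = sum ?t (Poly_Mapping.keys p)"
    by (rule poly_mapping_eqI) (auto simp: lookup_sum lookup_single when_def in_keys_iff)
  ultimately show ?thesis
    by (metis order_refl)
qed

lemma ncpoly_induct [case_names single add]:
  fixes p :: "'a ncpoly"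
  assumes "\<And>w a. P (Poly_Mapping.single w a)" and "\<And>p q. P p \<Longrightarrow> P q \<Longrightarrow> P (p + q)"
  shows "P p"
proof -
  have "p \<in> ncpolys UNIV \<infinity>"
    by (simp add: ncpolys_iff)
  then show ?thesis
    by (induction rule: ncpolys_induct) (auto intro: assms)
qed

section \<open>The involution\<close>

lemma lookup_ncstar: "Poly_Mapping.lookup (ncstar p) w = Poly_Mapping.lookup p (rev w)"
  by (simp add: ncstar_def map_key.rep_eq inj_on_def)

lemma ncstar_add: "ncstar (p + q) = ncstar p + ncstar q"
  by (rule poly_mapping_eqI) (simp add: lookup_ncstar lookup_add)

lemma ncstar_0: "ncstar 0 = 0"
  by (rule poly_mapping_eqI) (simp add: lookup_ncstar)

lemma ncstar_minus: "ncstar (p - q) = ncstar p - ncstar q"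
  by (rule poly_mapping_eqI) (simp add: lookup_ncstar lookup_minus)

lemma ncstar_sum: "ncstar (sum f I) = (\<Sum>i\<in>I. ncstar (f i))"
  by (induction I rule: infinite_finite_induct) (auto simp: ncstar_add ncstar_0)

lemma ncstar_single: "ncstar (Poly_Mapping.single w a) = Poly_Mapping.single (rev w) a"
  by (rule poly_mapping_eqI) (auto simp: lookup_ncstar lookup_single when_def)

lemma ncstar_mult: "ncstar (p * q) = ncstar q * ncstar p"
proof (induction p rule: ncpoly_induct)
  case (single u a)
  show ?case
    by (induction q rule: ncpoly_induct)
      (simp_all add: ncstar_single mult_single plus_list_def ncstar_add algebra_simps)
qed (simp add: ncstar_add algebra_simps)

lemma ncstar_one: "ncstar 1 = 1"
  using ncstar_single[of "[]" 1] by (simp add: single_Nil_1)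

lemma ncstar_ncvar: "ncstar (ncvar x) = ncvar x"
  by (simp add: ncvar_def ncword_def ncstar_single)

lemma ncstar_in_ncpolys: "p \<in> ncpolys X d \<Longrightarrow> ncstar p \<in> ncpolys X d"
  by (induction p rule: ncpolys_induct)
    (auto simp: ncstar_single ncstar_add intro: single_in_ncpolys add_in_ncpolys)

section \<open>Coefficients and degrees of products\<close>

text \<open>The empty word factors only as a concatenation of empty words. Hence taking the constant
  coefficient is multiplicative; point evaluations are built from it.\<close>

lemma lookup_mult_Nil:
  fixes p q :: "'a ncpoly"
  shows "Poly_Mapping.lookup (p * q) [] = Poly_Mapping.lookup p [] * Poly_Mapping.lookup q []"
proof (induction p rule: ncpoly_induct)
  case (single u a)
  show ?case
    by (induction q rule: ncpoly_induct)
      (auto simp: mult_single plus_list_def lookup_single lookup_add when_def algebra_simps)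
qed (simp add: lookup_add algebra_simps)

lemma lookup_ncscale_Nil: "Poly_Mapping.lookup (ncscale a p) [] = a * Poly_Mapping.lookup p []"
  by (simp add: ncscale_def lookup_mult_Nil)

text \<open>Among the factorizations of \<open>u @ w\<close>, only \<open>(u, w)\<close> has factors that are at most this long.\<close>

lemma lookup_mult_append:
  fixes p q :: "'a ncpoly"
  assumes "\<And>u'. u' \<in> Poly_Mapping.keys p \<Longrightarrow> length u' \<le> length u"
    and "\<And>w'. w' \<in> Poly_Mapping.keys q \<Longrightarrow> length w' \<le> length w"
  shows "Poly_Mapping.lookup (p * q) (u @ w) = Poly_Mapping.lookup p u * Poly_Mapping.lookup q w"
proof -
  define m n where "m = length u" and "n = length w"
  have "p \<in> ncpolys UNIV (enat m)" "q \<in> ncpolys UNIV (enat n)"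
    using assms by (auto simp: ncpolys_iff m_def n_def)
  then show ?thesis
  proof (induction p rule: ncpolys_induct)
    case (single u' a)
    from \<open>q \<in> ncpolys UNIV (enat n)\<close> show ?case
    proof (induction q rule: ncpolys_induct)
      case (single w' b)
      have "u' @ w' = u @ w \<longleftrightarrow> u' = u \<and> w' = w"
      proof
        assume *: "u' @ w' = u @ w"
        then have "length u' + length w' = length u + length w"
          by (metis length_append)
        then have "length u' = length u"
          using single \<open>enat (length u') \<le> enat m\<close> by (simp add: m_def n_def)
        with * show "u' = u \<and> w' = w"
          by simp
      qed simp
      then show ?case
        by (auto simp: mult_single plus_list_def lookup_single when_def)
    qed (simp add: lookup_add algebra_simps)
  qed (simp add: lookup_add algebra_simps)
qed

text \<open>Leading words cannot cancel in the free algebra. The truncated ideal bounds only the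
  degree of a product \<open>p * h\<close>; additivity turns this into a bound on
  \<open>ncdeg p + ncdeg h\<close>, which substitution then preserves.\<close>

lemma ncdeg_mult:
  fixes p q :: "'a ncpoly"
  assumes "p * q \<noteq> 0"
  shows "ncdeg (p * q) = ncdeg p + ncdeg q"
proof -
  have *: "\<exists>w\<in>Poly_Mapping.keys p. length w = ncdeg p" if "p \<noteq> 0" for p :: "'a ncpoly"
  proof -
    have "Max (length ` Poly_Mapping.keys p) \<in> length ` Poly_Mapping.keys p"
      using that by (intro Max_in) auto
    then show ?thesis
      using that by (force simp: ncdeg_def)
  qed
  have le: "length w \<le> ncdeg p" if "w \<in> Poly_Mapping.keys p" for w and p :: "'a ncpoly"
    using that enat_ncdeg_le_iff[of p "enat (ncdeg p)"] by simp
  have "p \<noteq> 0" "q \<noteq> 0"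
    using assms by auto
  with * obtain u w where u: "u \<in> Poly_Mapping.keys p" "length u = ncdeg p"
    and w: "w \<in> Poly_Mapping.keys q" "length w = ncdeg q"
    by metis
  \<comment> \<open>The coefficient at \<open>u @ w\<close> is a product of two nonzero coefficients
    at words of maximal length.\<close>
  then have "u @ w \<in> Poly_Mapping.keys (p * q)"
    using lookup_mult_append[of p u q w] le by (auto simp: in_keys_iff)
  then have "ncdeg p + ncdeg q \<le> ncdeg (p * q)"
    using le u w by fastforce
  moreover have "p * q \<in> ncpolys UNIV (enat (ncdeg p) + enat (ncdeg q))"
    by (rule mult_in_ncpolys) (simp_all add: ncpolys_iff le)
  then have "ncdeg (p * q) \<le> ncdeg p + ncdeg q"
    by (simp add: ncpolys_def)
  ultimately show ?thesis
    by simp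
qed

section \<open>Substitution homomorphisms\<close>

text \<open>The unital algebra homomorphism determined by \<open>s\<close> on the variables, written
  as the linear extension of its values on words.\<close>

definition ncsubst :: "('a \<Rightarrow> 'b ncpoly) \<Rightarrow> 'a ncpoly \<Rightarrow> 'b ncpoly" where
  "ncsubst s p = (\<Sum>w\<in>Poly_Mapping.keys p. ncscale (Poly_Mapping.lookup p w) (prod_list (map s w)))"

lemma ncsubst_add: "ncsubst s (p + q) = ncsubst s p + ncsubst s q"
  unfolding ncsubst_def
  by (rule setsum_keys_plus_distrib) (simp_all add: ncscale_def single_add algebra_simps)

lemma ncsubst_single: "ncsubst s (Poly_Mapping.single w a) = ncscale a (prod_list (map s w))"
  by (simp add: ncsubst_def ncscale_0)

lemma ncsubst_word: "ncsubst s (ncword w) = prod_list (map s w)"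
  by (simp add: ncword_def ncsubst_single ncscale_def single_Nil_1)

lemma ncsubst_0: "ncsubst s 0 = 0"
  by (simp add: ncsubst_def)

lemma ncsubst_1: "ncsubst s 1 = 1"
  using ncsubst_word[of s "[]"] by (simp add: ncword_Nil)

lemma ncsubst_ncvar: "ncsubst s (ncvar x) = s x"
  by (simp add: ncvar_def ncsubst_word)

text \<open>Scalars are central; this is what lets \<open>ncscale\<close>, a multiplication from the
  left, pass through products.\<close>

lemma single_Nil_commute:
  fixes p :: "'a ncpoly"
  shows "Poly_Mapping.single [] a * p = p * Poly_Mapping.single [] a"
  by (induction p rule: ncpoly_induct) (simp_all add: mult_single plus_list_def algebra_simps)

lemma ncscale_mult: "ncscale a p * ncscale b q = ncscale (a * b) (p * q)"
proof -
  let ?c = "Poly_Mapping.single []"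
  have "?c a * p * (?c b * q) = ?c a * (p * ?c b) * q"
    by (simp only: mult.assoc)
  also have "\<dots> = ?c a * ?c b * (p * q)"
    by (simp only: mult.assoc single_Nil_commute[of b p, symmetric])
  also have "?c a * ?c b = ?c (a * b)"
    by (simp add: mult_single plus_list_def)
  finally show ?thesis
    by (simp add: ncscale_def)
qed

lemma ncsubst_mult: "ncsubst s (p * q) = ncsubst s p * ncsubst s q"
proof (induction p rule: ncpoly_induct)
  case (single u a)
  show ?case
    by (induction q rule: ncpoly_induct)
      (simp_all add: ncsubst_single ncsubst_add mult_single plus_list_def ncscale_mult algebra_simps)
qed (simp add: ncsubst_add algebra_simps)

lemma ncsubst_scale: "ncsubst s (ncscale a p) = ncscale a (ncsubst s p)"
  by (simp add: ncscale_def ncsubst_mult ncsubst_single)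

lemma ncsubst_uminus: "ncsubst s (- p) = - ncsubst s p"
  using ncsubst_scale[of s "- 1" p] by (simp add: ncscale_minus1)

lemma ncsubst_diff: "ncsubst s (p - q) = ncsubst s p - ncsubst s q"
  using ncsubst_add[of s p "- q"] by (simp add: ncsubst_uminus)

lemma ncsubst_sum: "ncsubst s (sum f I) = (\<Sum>i\<in>I. ncsubst s (f i))"
  by (induction I rule: infinite_finite_induct) (auto simp: ncsubst_add ncsubst_0)

lemma prod_list_in_ncpolys:
  assumes "\<And>x. x \<in> X \<Longrightarrow> s x \<in> ncpolys Y 1" "w \<in> lists X"
  shows "prod_list (map s w) \<in> ncpolys Y (enat (length w))"
  using assms(2)
proof (induction w)
  case (Cons x w)
  then have "s x * prod_list (map s w) \<in> ncpolys Y (1 + enat (length w))"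
    by (intro mult_in_ncpolys assms(1)) auto
  then show ?case
    by (simp add: one_enat_def)
qed (simp add: one_in_ncpolys)

text \<open>A word of length \<open>n\<close> becomes a product of \<open>n\<close> factors of
  degree at most 1, so the truncation level is preserved.\<close>

lemma ncsubst_in_ncpolys:
  assumes "\<And>x. x \<in> X \<Longrightarrow> s x \<in> ncpolys Y 1" "p \<in> ncpolys X d"
  shows "ncsubst s p \<in> ncpolys Y d"
  using assms(2)
proof (induction rule: ncpolys_induct)
  case (single w a)
  then show ?case
    by (auto simp: ncsubst_single intro!: ncscale_in_ncpolys intro: ncpolys_mono[OF prod_list_in_ncpolys[OF assms(1)]])
qed (simp add: ncsubst_add add_in_ncpolys)

lemma ncstar_ncscale: "ncstar (ncscale a p) = ncscale a (ncstar p)"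
  by (simp add: ncscale_def ncstar_mult ncstar_single single_Nil_commute)

lemma ncstar_prod_list:
  assumes "\<And>x. x \<in> X \<Longrightarrow> ncstar (s x) = s x" "w \<in> lists X"
  shows "ncstar (prod_list (map s w)) = prod_list (map s (rev w))"
  using assms(2) by (induction w) (auto simp: ncstar_one ncstar_mult assms(1))

text \<open>Both sides reverse the order of the factors, and self-adjoint images of the variables
  are fixed by the involution.\<close>

lemma ncsubst_ncstar:
  assumes "\<And>x. x \<in> X \<Longrightarrow> ncstar (s x) = s x" "p \<in> ncpolys X d"
  shows "ncsubst s (ncstar p) = ncstar (ncsubst s p)"
  using assms(2)
proof (induction rule: ncpolys_induct)
  case (single w a)
  then show ?case
    using ncstar_prod_list[of X s w] assms(1) by (simp add: ncstar_single ncsubst_single ncstar_ncscale)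
qed (simp add: ncsubst_add ncstar_add)

section \<open>Linear functionals\<close>

lemma linear_add:
  "linear_functional X d L \<Longrightarrow> p \<in> ncpolys X d \<Longrightarrow> q \<in> ncpolys X d \<Longrightarrow> L (p + q) = L p + L q"
  by (simp add: linear_functional_def)

lemma linear_scale:
  "linear_functional X d L \<Longrightarrow> p \<in> ncpolys X d \<Longrightarrow> L (ncscale a p) = a * L p"
  by (simp add: linear_functional_def)

lemma linear_0: "linear_functional X d L \<Longrightarrow> L 0 = 0"
  using linear_scale[of X d L 0 0] by (simp add: zero_in_ncpolys ncscale_0)

lemma linear_uminus: "linear_functional X d L \<Longrightarrow> p \<in> ncpolys X d \<Longrightarrow> L (- p) = - L p"
  using linear_scale[of X d L p "- 1"] by (simp add: ncscale_minus1)

lemma linear_diff: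
  "linear_functional X d L \<Longrightarrow> p \<in> ncpolys X d \<Longrightarrow> q \<in> ncpolys X d \<Longrightarrow> L (p - q) = L p - L q"
  using linear_add[of X d L p "- q"] by (simp add: linear_uminus uminus_in_ncpolys)

lemma linear_sum:
  assumes "linear_functional X d L" "\<And>i. i \<in> I \<Longrightarrow> f i \<in> ncpolys X d"
  shows "L (sum f I) = (\<Sum>i\<in>I. L (f i))"
  using assms(2)
  by (induction I rule: infinite_finite_induct)
    (auto simp: linear_0[OF assms(1)] linear_add[OF assms(1)] sum_in_ncpolys)

lemma linear_sum_eq_0:
  assumes "linear_functional X d L" "\<And>i. i \<in> I \<Longrightarrow> f i \<in> ncpolys X d \<and> L (f i) = 0"
  shows "L (sum f I) = 0"
  using linear_sum[of X d L I f] assms by simp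

text \<open>Bilinear extension of the trace identity from words. Bounding the two factors separately
  keeps every product of their terms within degree \<open>d\<close>, where \<open>L\<close> is
  linear.\<close>

lemma tracial_mult:
  assumes L: "linear_functional X d L" "tracial X d L"
    and "p \<in> ncpolys X m" "q \<in> ncpolys X n" "m + n \<le> d"
  shows "L (p * q) = L (q * p)"
proof -
  have mem: "f * g \<in> ncpolys X d" "g * f \<in> ncpolys X d"
    if "f \<in> ncpolys X m" "g \<in> ncpolys X n" for f g
    using that \<open>m + n \<le> d\<close> by (metis add.commute mult_in_ncpolys ncpolys_mono)+
  from \<open>p \<in> ncpolys X m\<close> \<open>q \<in> ncpolys X n\<close> show ?thesis
  proof (induction p rule: ncpolys_induct)
    case (single u a)
    from \<open>q \<in> ncpolys X n\<close> show ?case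
    proof (induction q rule: ncpolys_induct)
      case (single w b)
      have "enat (length (u @ w)) \<le> d"
        using enat_length_append_le[of u m w n] single \<open>enat (length u) \<le> m\<close> \<open>m + n \<le> d\<close>
        by (meson order_trans)
      moreover have "u @ w \<in> lists X" "w @ u \<in> lists X"
        using single \<open>u \<in> lists X\<close> by auto
      moreover have "L (ncword (u @ w)) = L (ncword (w @ u))"
        using L(2) calculation single(1) \<open>u \<in> lists X\<close> unfolding tracial_def by blast
      ultimately have "L (ncscale (a * b) (ncword (u @ w))) = L (ncscale (a * b) (ncword (w @ u)))"
        by (simp add: linear_scale[OF L(1)] ncword_in_ncpolys add.commute)
      then show ?case
        by (simp add: ncword_def ncscale_single mult_single plus_list_def mult.commute)
    next
      case (add f g)
      then show ?case
        using mem[OF single_in_ncpolys[OF \<open>u \<in> lists X\<close> \<open>enat (length u) \<le> m\<close>]]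
        by (simp add: algebra_simps linear_add[OF L(1)])
    qed
  next
    case (add f g)
    then show ?case
      using mem[OF _ \<open>q \<in> ncpolys X n\<close>] by (simp add: algebra_simps linear_add[OF L(1)])
  qed
qed

lemma symmetric_ncstar:
  assumes L: "linear_functional X d L" "symmetric X d L" and "p \<in> ncpolys X d"
  shows "L (ncstar p) = L p"
  using assms(3)
proof (induction p rule: ncpolys_induct)
  case (single w a)
  then have "L (ncword w) = L (ncword (rev w))"
    using L(2) unfolding symmetric_def by blast
  then have "L (ncscale a (ncword (rev w))) = L (ncscale a (ncword w))"
    using single by (simp add: linear_scale[OF L(1)] ncword_in_ncpolys rev_in_lists)
  then show ?case
    by (simp add: ncstar_single ncword_def ncscale_single)
qed (simp add: ncstar_add ncstar_in_ncpolys linear_add[OF L(1)])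

section \<open>Finite rank\<close>

text \<open>
  Finite rank as a rank factorization: this form is stable under substitutions and sums without
  any linear algebra.
\<close>

definition finite_factorization :: "'i set \<Rightarrow> 'j set \<Rightarrow> ('i \<Rightarrow> 'j \<Rightarrow> real) \<Rightarrow> bool" where
  "finite_factorization I J M \<longleftrightarrow>
     (\<exists>n A B. \<forall>i\<in>I. \<forall>j\<in>J. M i j = (\<Sum>t<(n::nat). A i t * B t j))"

lemma finite_factorizationI:
  assumes "finite T" "\<And>i j. i \<in> I \<Longrightarrow> j \<in> J \<Longrightarrow> M i j = (\<Sum>t\<in>T. A i t * B t j)"
  shows "finite_factorization I J M"
proof -
  obtain h where h: "bij_betw h {..<card T} T"
    using ex_bij_betw_nat_finite[OF assms(1)] by (auto simp: atLeast0LessThan)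
  have "M i j = (\<Sum>t<card T. A i (h t) * B (h t) j)" if "i \<in> I" "j \<in> J" for i j
    using assms(2)[OF that] sum.reindex_bij_betw[OF h, of "\<lambda>t. A i t * B t j"] by simp
  then show ?thesis
    unfolding finite_factorization_def
    by (intro exI[of _ "card T"] exI[of _ "\<lambda>i t. A i (h t)"] exI[of _ "\<lambda>t. B (h t)"]) simp
qed

text \<open>Place the factors side by side: the inner index set of the sum is the disjoint union of
  the inner index sets.\<close>

lemma finite_factorization_sum:
  assumes "finite C" "\<And>c. c \<in> C \<Longrightarrow> finite_factorization I J (M c)"
  shows "finite_factorization I J (\<lambda>i j. \<Sum>c\<in>C. M c i j)"
proof -
  have "\<forall>c\<in>C. \<exists>n A B. \<forall>i\<in>I. \<forall>j\<in>J. M c i j = (\<Sum>t<(n::nat). A i t * B t j)"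
    using assms(2) by (simp add: finite_factorization_def)
  then obtain n A B where
    *: "\<And>c i j. c \<in> C \<Longrightarrow> i \<in> I \<Longrightarrow> j \<in> J \<Longrightarrow> M c i j = (\<Sum>t<(n c::nat). A c i t * B c t j)"
    by metis
  let ?T = "SIGMA c:C. {..<n c}"
  let ?A = "\<lambda>i p. A (fst p) i (snd p)" and ?B = "\<lambda>p j. B (fst p) (snd p) j"
  have "(\<Sum>c\<in>C. M c i j) = (\<Sum>p\<in>?T. ?A i p * ?B p j)" if "i \<in> I" "j \<in> J" for i j
    using assms(1) that by (simp add: * sum.Sigma case_prod_unfold)
  then show ?thesis
    using assms(1) by (intro finite_factorizationI[of ?T _ _ _ ?A ?B]) auto
qed

section \<open>Linear dependence and rank factorizations\<close>

text \<open>Gaussian elimination, one coordinate at a time: more than \<open>n\<close> vectors with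
  \<open>n\<close> coordinates are linearly dependent.\<close>

lemma ex_nontrivial_relation:
  fixes v :: "'j \<Rightarrow> nat \<Rightarrow> real"
  assumes "finite S" "n < card S"
  shows "\<exists>a. (\<exists>j\<in>S. a j \<noteq> 0) \<and> (\<forall>t<n. (\<Sum>j\<in>S. a j * v j t) = 0)"
  using assms
proof (induction n arbitrary: S v)
  case 0
  then have "S \<noteq> {}"
    by auto
  then show ?case
    by (intro exI[of _ "\<lambda>_. 1"]) auto
next
  case (Suc n)
  show ?case
  proof (cases "\<forall>j\<in>S. v j n = 0")
    case True
    obtain a where "\<exists>j\<in>S. a j \<noteq> 0" "\<forall>t<n. (\<Sum>j\<in>S. a j * v j t) = 0"
      using Suc.IH[of S v] Suc.prems by auto
    with True show ?thesis
      by (intro exI[of _ a]) (auto simp: less_Suc_eq)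
  next
    case False
    then obtain k where k: "k \<in> S" "v k n \<noteq> 0"
      by blast
    let ?S = "S - {k}"
    \<comment> \<open>\<open>q j\<close> is the multiple of the pivot vector \<open>v k\<close>
      whose subtraction from \<open>v j\<close> clears coordinate \<open>n\<close>.\<close>
    define q where "q j = v j n / v k n" for j
    have "n < card ?S"
      using Suc.prems k by simp
    then obtain a where a: "\<exists>j\<in>?S. a j \<noteq> 0" "\<forall>t<n. (\<Sum>j\<in>?S. a j * (v j t - q j * v k t)) = 0"
      using Suc.IH[of ?S "\<lambda>j t. v j t - q j * v k t"] Suc.prems by auto
    \<comment> \<open>The coefficient at the pivot collects all subtracted multiples, so
      \<open>b\<close> gives the same combination of the original vectors as \<open>a\<close> gives
      of the reduced ones.\<close>
    define b where "b = (\<lambda>j. if j = k then - (\<Sum>j\<in>?S. a j * q j) else a j)"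
    have b: "(\<Sum>j\<in>S. b j * v j t) = (\<Sum>j\<in>?S. a j * (v j t - q j * v k t))" for t
    proof -
      have "(\<Sum>j\<in>S. b j * v j t) = b k * v k t + (\<Sum>j\<in>?S. b j * v j t)"
        using sum.remove[OF Suc.prems(1) k(1)] by auto
      also have "(\<Sum>j\<in>?S. b j * v j t) = (\<Sum>j\<in>?S. a j * v j t)"
        by (intro sum.cong) (auto simp: b_def)
      finally show ?thesis
        by (simp add: b_def sum_distrib_right sum_subtractf right_diff_distrib mult.assoc)
    qed
    have "(\<Sum>j\<in>S. b j * v j t) = 0" if "t < Suc n" for t
      using that a(2) k(2) by (cases "t = n") (auto simp: b q_def)
    moreover have "\<exists>j\<in>S. b j \<noteq> 0"
      using a(1) by (auto simp: b_def)
    ultimately show ?thesis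
      by blast
  qed
qed

text \<open>A factorization through \<open>n\<close> indices leaves no room for more than
  \<open>n\<close> independent columns. Conversely, a largest independent set of columns spans all
  columns, and the expansion coefficients form the second factor.\<close>

lemma finite_rank_iff: "matrix_rank I J M < \<infinity> \<longleftrightarrow> finite_factorization I J M"
proof
  assume "finite_factorization I J M"
  then obtain n A B where *: "\<And>i j. i \<in> I \<Longrightarrow> j \<in> J \<Longrightarrow> M i j = (\<Sum>t<(n::nat). A i t * B t j)"
    unfolding finite_factorization_def by blast
  have "card S \<le> n" if S: "finite S" "S \<subseteq> J" "indep_columns I M S" for S
  proof (rule ccontr)
    assume "\<not> card S \<le> n"
    \<comment> \<open>A relation among the columns of the factor \<open>B\<close> carries over to
      the columns of \<open>M\<close>.\<close>
    then obtain a where a: "\<exists>j\<in>S. a j \<noteq> 0" "\<forall>t<n. (\<Sum>j\<in>S. a j * B t j) = 0"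
      using ex_nontrivial_relation[of S n "\<lambda>j t. B t j"] S(1) by auto
    have "(\<Sum>j\<in>S. a j * M i j) = 0" if "i \<in> I" for i
    proof -
      have "(\<Sum>j\<in>S. a j * M i j) = (\<Sum>j\<in>S. \<Sum>t<n. A i t * (a j * B t j))"
        using S(2) that by (intro sum.cong) (auto simp: * sum_distrib_left mult_ac)
      also have "\<dots> = (\<Sum>t<n. \<Sum>j\<in>S. A i t * (a j * B t j))"
        by (rule sum.swap)
      also have "\<dots> = (\<Sum>t<n. A i t * (\<Sum>j\<in>S. a j * B t j))"
        by (simp add: sum_distrib_left)
      finally show ?thesis
        using a(2) by simp
    qed
    then show False
      using a(1) S(3) unfolding indep_columns_def by blast
  qed
  then have "matrix_rank I J M \<le> enat n"
    unfolding matrix_rank_def by (auto intro!: Sup_least)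
  then show "matrix_rank I J M < \<infinity>"
    by (rule order_le_less_trans) simp
next
  assume "matrix_rank I J M < \<infinity>"
  then obtain n where n: "matrix_rank I J M = enat n"
    by (cases "matrix_rank I J M") auto
  define P where "P k \<longleftrightarrow> (\<exists>S. finite S \<and> S \<subseteq> J \<and> indep_columns I M S \<and> card S = k)" for k
  have "k \<le> n" if "P k" for k
  proof -
    have "enat k \<le> matrix_rank I J M"
      using that unfolding matrix_rank_def P_def by (intro Sup_upper) blast
    then show ?thesis
      by (simp add: n)
  qed
  moreover have "P 0"
    unfolding P_def by (intro exI[of _ "{}"]) (simp add: indep_columns_def)
  \<comment> \<open>Finite rank bounds the sizes of independent sets, so there is one of maximal
    size \<open>k\<close>.\<close>
  ultimately obtain k where k: "P k" "\<And>l. P l \<Longrightarrow> l \<le> k"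
    using Nat.ex_has_greatest_nat[of P 0 n] by metis
  then obtain S where S: "finite S" "S \<subseteq> J" "indep_columns I M S" "card S = k"
    by (auto simp: P_def)
  have "\<exists>b. \<forall>i\<in>I. M i j = (\<Sum>s\<in>S. M i s * b s)" if "j \<in> J" for j
  proof (cases "j \<in> S")
    case True
    then show ?thesis
      using S(1) by (intro exI[of _ "\<lambda>s. if s = j then 1 else 0"]) (simp add: if_distrib[of "\<lambda>x. _ * x"] cong: if_cong)
  next
    case False
    have "\<not> indep_columns I M (insert j S)"
    proof
      assume "indep_columns I M (insert j S)"
      then have "P (Suc k)"
        unfolding P_def using S \<open>j \<in> J\<close> False by (intro exI[of _ "insert j S"]) auto
      with k(2) show False
        by fastforce
    qed
    then obtain a where a: "\<forall>i\<in>I. (\<Sum>s\<in>insert j S. a s * M i s) = 0" "\<exists>s\<in>insert j S. a s \<noteq> 0"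
      unfolding indep_columns_def by blast
    then have a1: "a j * M i j + (\<Sum>s\<in>S. a s * M i s) = 0" if "i \<in> I" for i
      using S(1) False that by simp
    \<comment> \<open>Otherwise the relation would involve only columns of \<open>S\<close>, which
      are independent.\<close>
    have "a j \<noteq> 0"
    proof
      assume "a j = 0"
      with a1 have "\<forall>i\<in>I. (\<Sum>s\<in>S. a s * M i s) = 0"
        by simp
      then have "\<forall>s\<in>S. a s = 0"
        using S(3) unfolding indep_columns_def by blast
      with \<open>a j = 0\<close> a(2) show False
        by blast
    qed
    have "M i j = (\<Sum>s\<in>S. M i s * (- a s / a j))" if "i \<in> I" for i
    proof -
      have "M i j = - (\<Sum>s\<in>S. a s * M i s) / a j"
        using a1[OF that] \<open>a j \<noteq> 0\<close> by (simp add: field_simps)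
      also have "\<dots> = (\<Sum>s\<in>S. M i s * (- a s / a j))"
        by (simp add: sum_divide_distrib sum_negf mult.commute)
      finally show ?thesis .
    qed
    then show ?thesis
      by (intro exI[of _ "\<lambda>s. - a s / a j"]) blast
  qed
  then have "\<exists>b. \<forall>j\<in>J. \<forall>i\<in>I. M i j = (\<Sum>s\<in>S. M i s * b j s)"
    by (intro bchoice) blast
  then obtain b where b: "\<And>i j. i \<in> I \<Longrightarrow> j \<in> J \<Longrightarrow> M i j = (\<Sum>s\<in>S. M i s * b j s)"
    by blast
  show "finite_factorization I J M"
    by (rule finite_factorizationI[OF S(1) b])
qed

text \<open>Substitution turns words into polynomials, so the factorization of the moment matrix has
  to be extended bilinearly from words to all polynomials.\<close>

lemma moment_factorization:
  assumes L: "linear_functional X \<infinity> L"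
    and "matrix_rank (lists X) (lists X) (moment_matrix L) < \<infinity>"
  shows "\<exists>n F G. \<forall>f\<in>ncpolys X \<infinity>. \<forall>g\<in>ncpolys X \<infinity>. L (ncstar f * g) = (\<Sum>t<(n::nat). F f t * G t g)"
proof -
  obtain n A B where *: "\<forall>u\<in>lists X. \<forall>w\<in>lists X. moment_matrix L u w = (\<Sum>t<(n::nat). A u t * B t w)"
    using assms(2) unfolding finite_rank_iff finite_factorization_def by blast
  \<comment> \<open>\<open>F\<close> and \<open>G\<close> are the linear extensions of the factors
    \<open>A\<close> and \<open>B\<close>.\<close>
  define F where "F f t = (\<Sum>u\<in>Poly_Mapping.keys f. Poly_Mapping.lookup f u * A u t)" for f t
  define G where "G t g = (\<Sum>w\<in>Poly_Mapping.keys g. Poly_Mapping.lookup g w * B t w)" for t g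
  have F_add: "F (f + g) t = F f t + F g t" for f g t
    unfolding F_def by (rule setsum_keys_plus_distrib) (simp_all add: algebra_simps)
  have G_add: "G t (f + g) = G t f + G t g" for f g t
    unfolding G_def by (rule setsum_keys_plus_distrib) (simp_all add: algebra_simps)
  have mem: "ncstar f * g \<in> ncpolys X \<infinity>" if "f \<in> ncpolys X \<infinity>" "g \<in> ncpolys X \<infinity>" for f g
    using mult_in_ncpolys[OF ncstar_in_ncpolys[OF that(1)] that(2)] by simp
  have "L (ncstar f * g) = (\<Sum>t<n. F f t * G t g)"
    if "f \<in> ncpolys X \<infinity>" "g \<in> ncpolys X \<infinity>" for f g
    using that(1)
  proof (induction f rule: ncpolys_induct)
    case (single u a)
    note u = single
    from that(2) show ?case
    proof (induction g rule: ncpolys_induct)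
      case (single w b)
      have "ncstar (Poly_Mapping.single u a) * Poly_Mapping.single w b
          = ncscale (a * b) (ncword (rev u @ w))"
        by (simp add: ncstar_single mult_single plus_list_def ncword_def ncscale_single)
      moreover have "rev u @ w \<in> lists X"
        using u single by (simp add: rev_in_lists)
      ultimately have "L (ncstar (Poly_Mapping.single u a) * Poly_Mapping.single w b)
          = a * b * moment_matrix L u w"
        by (simp add: moment_matrix_def linear_scale[OF L] ncword_in_ncpolys)
      also have "\<dots> = (\<Sum>t<n. (a * A u t) * (b * B t w))"
        using * u single by (simp add: sum_distrib_left mult_ac)
      finally show ?case
        by (simp add: F_def G_def)
    next
      case (add g h)
      moreover have "Poly_Mapping.single u a \<in> ncpolys X \<infinity>"
        using u by (simp add: single_in_ncpolys)
      ultimately show ?case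
        by (simp add: distrib_left linear_add[OF L] mem G_add sum.distrib)
    qed
  next
    case (add f h)
    with that(2) show ?case
      by (simp add: ncstar_add distrib_right linear_add[OF L] mem F_add sum.distrib)
  qed
  then show ?thesis
    by blast
qed

section \<open>Constructions of admissible functionals\<close>

text \<open>Degrees, involution and products are respected by the substitution, so everything except
  the relations transfers. The assumption on \<open>H\<close> multiplies each relation by an
  arbitrary \<open>q\<close> of degree at most \<open>m\<close>, since the image of the left
  multiplier \<open>p\<close> may be any such polynomial.\<close>

lemma admissible_pullback:
  assumes L: "admissible Y r H' L"
    and s: "\<And>x. x \<in> X \<Longrightarrow> s x \<in> ncpolys Y 1" "\<And>x. x \<in> X \<Longrightarrow> ncstar (s x) = s x"
    and rel: "\<And>h q m. h \<in> H \<Longrightarrow> q \<in> ncpolys Y (enat m) \<Longrightarrow> enat (m + ncdeg h) \<le> 2 * level_bound r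
      \<Longrightarrow> L (q * ncsubst s h) = 0"
  shows "admissible X r H (\<lambda>p. L (ncsubst s p))"
proof -
  let ?d = "2 * level_bound r"
  have lin: "linear_functional Y ?d L" and sym: "symmetric Y ?d L" and tr: "tracial Y ?d L"
    and pos: "positive Y (level_bound r) L"
    and rk: "r = Star \<Longrightarrow> matrix_rank (lists Y) (lists Y) (moment_matrix L) < \<infinity>"
    using L by (auto simp: admissible_def)
  have mem: "ncsubst s p \<in> ncpolys Y e" if "p \<in> ncpolys X e" for p e
    using ncsubst_in_ncpolys[OF s(1) that] .
  have star: "ncsubst s (ncstar p) = ncstar (ncsubst s p)" if "p \<in> ncpolys X e" for p e
    using ncsubst_ncstar[OF s(2) that] .
  have "linear_functional X ?d (\<lambda>p. L (ncsubst s p))"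
    unfolding linear_functional_def
    by (simp add: ncsubst_add ncsubst_scale linear_add[OF lin] linear_scale[OF lin] mem)
  moreover have "symmetric X ?d (\<lambda>p. L (ncsubst s p))"
    unfolding symmetric_def
  proof (intro ballI impI)
    fix w assume "w \<in> lists X" "enat (length w) \<le> ?d"
    then have w: "ncword w \<in> ncpolys X ?d"
      by (rule ncword_in_ncpolys)
    have "ncword (rev w) = ncstar (ncword w)"
      by (simp add: ncword_def ncstar_single)
    then show "L (ncsubst s (ncword w)) = L (ncsubst s (ncword (rev w)))"
      using symmetric_ncstar[OF lin sym mem[OF w]] star[OF w] by simp
  qed
  moreover have "tracial X ?d (\<lambda>p. L (ncsubst s p))"
    unfolding tracial_def
  proof (intro ballI impI)
    fix u w assume uw: "u \<in> lists X" "w \<in> lists X" and len: "enat (length (u @ w)) \<le> ?d"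
    have "ncsubst s (ncword u) \<in> ncpolys Y (enat (length u))"
      "ncsubst s (ncword w) \<in> ncpolys Y (enat (length w))"
      using uw by (simp_all add: mem ncword_in_ncpolys)
    then have "L (ncsubst s (ncword u) * ncsubst s (ncword w)) = L (ncsubst s (ncword w) * ncsubst s (ncword u))"
      by (rule tracial_mult[OF lin tr]) (use len in simp)
    then show "L (ncsubst s (ncword (u @ w))) = L (ncsubst s (ncword (w @ u)))"
      by (simp add: ncword_append ncsubst_mult)
  qed
  moreover have "positive X (level_bound r) (\<lambda>p. L (ncsubst s p))"
    using pos mem star by (simp add: positive_def ncsubst_mult)
  moreover have "L (ncsubst s f) = 0" if "f \<in> trunc_ideal X ?d H" for f
  \<comment> \<open>Additivity of degrees needs a nonzero product: a vanishing one says nothing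
    about the degrees of its factors.\<close>
  proof (cases "f = 0")
    case True
    then show ?thesis
      using linear_0[OF lin] by (simp add: ncsubst_0)
  next
    case False
    from that obtain p h where ph: "f = p * h" "p \<in> ncpolys X \<infinity>" "h \<in> H" "enat (ncdeg (p * h)) \<le> ?d"
      by (auto simp: trunc_ideal_def)
    have "ncsubst s p \<in> ncpolys Y (enat (ncdeg p))"
      by (intro mem in_ncpolys_ncdeg ph)
    with rel[OF ph(3) this] ph False show ?thesis
      by (simp add: ncsubst_mult ncdeg_mult)
  qed
  moreover have "matrix_rank (lists X) (lists X) (moment_matrix (\<lambda>p. L (ncsubst s p))) < \<infinity>"
    if r: "r = Star"
  proof -
    have "linear_functional Y \<infinity> L"
      using lin r by (simp add: numeral_eq_enat)
    then obtain n F G where FG: "\<forall>f\<in>ncpolys Y \<infinity>. \<forall>g\<in>ncpolys Y \<infinity>.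
        L (ncstar f * g) = (\<Sum>t<(n::nat). F f t * G t g)"
      using moment_factorization[OF _ rk[OF r]] by blast
    \<comment> \<open>The factors of the pullback are those of \<open>L\<close>, evaluated at the
      images of the words.\<close>
    have "moment_matrix (\<lambda>p. L (ncsubst s p)) u w
        = (\<Sum>t<n. F (ncsubst s (ncword u)) t * G t (ncsubst s (ncword w)))"
      if "u \<in> lists X" "w \<in> lists X" for u w
    proof -
      have w: "ncword u \<in> ncpolys X \<infinity>" "ncword w \<in> ncpolys X \<infinity>"
        using that by (simp_all add: ncword_in_ncpolys)
      have "ncword (rev u) = ncstar (ncword u)"
        by (simp add: ncword_def ncstar_single)
      then have "ncsubst s (ncword (rev u @ w)) = ncstar (ncsubst s (ncword u)) * ncsubst s (ncword w)"
        using star[OF w(1)] by (simp add: ncword_append ncsubst_mult)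
      then show ?thesis
        using FG w mem by (simp add: moment_matrix_def)
    qed
    then show ?thesis
      unfolding finite_rank_iff by (intro finite_factorizationI[of "{..<n}"]) auto
  qed
  ultimately show ?thesis
    by (simp add: admissible_def)
qed

text \<open>The constraints define a convex cone, as no value of \<open>L 1\<close> is prescribed;
  the rank condition survives by \<open>finite_factorization_sum\<close>.\<close>

lemma admissible_sum:
  assumes "finite C" and L: "\<And>c. c \<in> C \<Longrightarrow> admissible X r H (L c)"
  shows "admissible X r H (\<lambda>p. \<Sum>c\<in>C. L c p)"
proof -
  let ?d = "2 * level_bound r"
  have "linear_functional X ?d (\<lambda>p. \<Sum>c\<in>C. L c p)"
    using L by (auto simp: admissible_def linear_functional_def sum_distrib_left sum.distrib[symmetric]
        intro!: sum.cong)
  moreover have "symmetric X ?d (\<lambda>p. \<Sum>c\<in>C. L c p)"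
    using L unfolding admissible_def symmetric_def by (blast intro: sum.cong)
  moreover have "tracial X ?d (\<lambda>p. \<Sum>c\<in>C. L c p)"
    using L unfolding admissible_def tracial_def by (blast intro: sum.cong)
  moreover have "positive X (level_bound r) (\<lambda>p. \<Sum>c\<in>C. L c p)"
    using L unfolding admissible_def positive_def by (blast intro: sum_nonneg)
  moreover have "\<forall>f\<in>trunc_ideal X ?d H. (\<Sum>c\<in>C. L c f) = 0"
    using L unfolding admissible_def by (blast intro: sum.neutral)
  moreover have "matrix_rank (lists X) (lists X) (moment_matrix (\<lambda>p. \<Sum>c\<in>C. L c p)) < \<infinity>"
    if "r = Star"
  proof -
    have "finite_factorization (lists X) (lists X) (\<lambda>u w. \<Sum>c\<in>C. moment_matrix (L c) u w)"
      using L that by (intro finite_factorization_sum assms(1)) (simp add: admissible_def flip: finite_rank_iff)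
    then show ?thesis
      unfolding finite_rank_iff by (simp add: moment_matrix_def[abs_def])
  qed
  ultimately show ?thesis
    by (simp add: admissible_def)
qed

text \<open>This is evaluation at the origin. Its moment matrix has a single nonzero entry, at the
  pair of empty words, and so has rank one.\<close>

lemma admissible_constant_coefficient: "admissible X r {} (\<lambda>p. Poly_Mapping.lookup p [])"
proof -
  have "moment_matrix (\<lambda>p. Poly_Mapping.lookup p []) u w
      = (\<Sum>t\<in>{()}. of_bool (u = []) * of_bool (w = []))" for u w :: "'a list"
    by (simp add: moment_matrix_def ncword_def lookup_single when_def)
  then have "matrix_rank (lists X) (lists X) (moment_matrix (\<lambda>p. Poly_Mapping.lookup p [])) < \<infinity>"
    unfolding finite_rank_iff by (intro finite_factorizationI[of "{()}"]) auto
  then show ?thesis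
    by (auto simp: admissible_def linear_functional_def lookup_add ncscale_def lookup_mult_Nil
        symmetric_def tracial_def positive_def lookup_ncstar trunc_ideal_def ncword_def lookup_single when_def)
qed

text \<open>Evaluation at the real point \<open>a\<close>, encoded as the constant coefficient after
  substituting scalars so that \<open>admissible_pullback\<close> applies to it.\<close>

definition character :: "('a \<Rightarrow> real) \<Rightarrow> 'a ncpoly \<Rightarrow> real" where
  "character a p =
     Poly_Mapping.lookup (ncsubst (\<lambda>x. Poly_Mapping.single [] (a x)) p :: 'a ncpoly) []"

lemma character_simps:
  "character a 1 = 1"
  "character a (ncvar x) = a x"
  "character a (p + q) = character a p + character a q"
  "character a (p - q) = character a p - character a q"
  "character a (p * q) = character a p * character a q"
  "character a (sum f I) = (\<Sum>i\<in>I. character a (f i))"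
  by (simp_all add: character_def ncsubst_1 ncsubst_ncvar ncsubst_add ncsubst_diff ncsubst_mult
      ncsubst_sum lookup_add lookup_minus lookup_sum lookup_mult_Nil lookup_one zero_list_def)

text \<open>An evaluation is multiplicative, so vanishing on the relations makes it vanish on all
  their left multiples.\<close>

lemma admissible_character:
  assumes "\<And>h. h \<in> H \<Longrightarrow> character a h = 0"
  shows "admissible X r H (character a)"
  unfolding character_def[abs_def]
  by (rule admissible_pullback[OF admissible_constant_coefficient[of UNIV]])
    (use assms in \<open>auto simp: character_def ncstar_single lookup_mult_Nil intro!: single_in_ncpolys simp flip: zero_enat_def\<close>)

lemma admissible_ideal:
  assumes "admissible X r H L" "h \<in> H" "p \<in> ncpolys X \<infinity>" "p * h \<in> ncpolys X (2 * level_bound r)"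
  shows "L (p * h) = 0"
proof -
  have "p * h \<in> trunc_ideal X (2 * level_bound r) H"
    unfolding trunc_ideal_def using assms(2-4) by (auto simp: ncpolys_def)
  with assms(1) show ?thesis
    by (simp add: admissible_def)
qed

text \<open>\<open>F\<close> is a family of variables with sum 1 modulo the relations: all colours
  at one vertex, or all vertices at one colour. The order \<open>ncvar a * ncvar b\<close> suits an
  ideal that is closed under multiplication from the left.\<close>

lemma admissible_projection_relation:
  assumes L: "admissible Y r H L"
    and F: "F \<subseteq> Y" "finite F" "a \<in> F"
    and H: "1 - (\<Sum>b\<in>F. ncvar b) \<in> H" "\<And>b. b \<in> F \<Longrightarrow> b \<noteq> a \<Longrightarrow> ncvar a * ncvar b \<in> H"
    and q: "q \<in> ncpolys Y m" "m + 2 \<le> 2 * level_bound r"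
  shows "L (q * (ncvar a - ncvar a * ncvar a)) = 0"
proof -
  let ?d = "2 * level_bound r"
  have lin: "linear_functional Y ?d L"
    using L by (simp add: admissible_def)
  have var: "ncvar b \<in> ncpolys Y 1" if "b \<in> F" for b
    using that F(1) by (auto intro: ncvar_in_ncpolys)
  have two: "m + 1 + 1 \<le> ?d"
    using q(2) by (simp add: add.assoc)
  have quadratic: "q * ncvar a * f \<in> ncpolys Y ?d" if "f \<in> ncpolys Y 1" for f
    using mult_in_ncpolys[OF mult_in_ncpolys[OF q(1) var[OF F(3)]] that] two by (rule ncpolys_mono)
  have q_unbounded: "q * ncvar a \<in> ncpolys Y \<infinity>" "q \<in> ncpolys Y \<infinity>"
    using mult_in_ncpolys[OF q(1) var[OF F(3)]] q(1) by (auto intro: ncpolys_unbounded)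
  have split: "(\<Sum>b\<in>F. ncvar b) = ncvar a + (\<Sum>b\<in>F - {a}. ncvar b)"
    using F by (simp add: sum.remove)
  \<comment> \<open>Each summand on the right is a left multiple of a relation and has degree at
    most \<open>m + 2\<close>, so it lies in the truncated ideal.\<close>
  have "q * (ncvar a - ncvar a * ncvar a)
      = q * ncvar a * (1 - (\<Sum>b\<in>F. ncvar b)) + (\<Sum>b\<in>F - {a}. q * ncvar a * ncvar b)"
    by (simp add: split algebra_simps sum_distrib_left)
  moreover have rest: "q * ncvar a * (1 - (\<Sum>b\<in>F. ncvar b)) \<in> ncpolys Y ?d"
    by (intro quadratic diff_in_ncpolys one_in_ncpolys sum_in_ncpolys var)
  moreover have "L (q * ncvar a * (1 - (\<Sum>b\<in>F. ncvar b))) = 0"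
    by (rule admissible_ideal[OF L H(1) q_unbounded(1) rest])
  moreover have "L (q * ncvar a * ncvar b) = 0" if "b \<in> F - {a}" for b
  proof -
    have "L (q * (ncvar a * ncvar b)) = 0"
      using that quadratic[OF var] by (intro admissible_ideal[OF L H(2) q_unbounded(2)]) (auto simp: mult.assoc)
    then show ?thesis
      by (simp add: mult.assoc)
  qed
  moreover have monomial: "q * ncvar a * ncvar b \<in> ncpolys Y ?d" if "b \<in> F - {a}" for b
    using that by (intro quadratic var) auto
  then have "(\<Sum>b\<in>F - {a}. q * ncvar a * ncvar b) \<in> ncpolys Y ?d"
    by (rule sum_in_ncpolys)
  moreover have "L (\<Sum>b\<in>F - {a}. q * ncvar a * ncvar b) = (\<Sum>b\<in>F - {a}. L (q * ncvar a * ncvar b))"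
    by (rule linear_sum[OF lin]) (use monomial in blast)
  ultimately show ?thesis
    using linear_add[OF lin] by simp
qed

lemma sum_singleton_Times: "sum f ({a} \<times> B) = (\<Sum>b\<in>B. f (a, b))"
  using sum.cartesian_product[of "\<lambda>x y. f (x, y)" B "{a}"] by simp

section \<open>Colourings and stable sets\<close>

text \<open>Each relation has a word of length 2 with coefficient 1 or -1. Hence a left multiplier
  within the degree bound leaves two degrees free, as \<open>admissible_projection_relation\<close>
  requires.\<close>

lemma ncdeg_H_graph:
  assumes "h \<in> H_graph V E"
  shows "2 \<le> ncdeg h"
proof -
  have mult: "ncvar i * ncvar j = Poly_Mapping.single [i, j] 1" for i j :: 'a
    by (simp add: ncvar_def ncword_def mult_single plus_list_def)
  from assms consider i where "h = ncvar i - ncvar i ^ 2" | i j where "h = ncvar i * ncvar j"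
    by (auto simp: H_graph_def)
  then have "\<exists>i j. Poly_Mapping.lookup h [i, j] \<noteq> 0"
  proof cases
    case (1 i)
    then have "Poly_Mapping.lookup h [i, i] = - 1"
      by (simp add: power2_eq_square mult lookup_minus) (simp add: lookup_single ncvar_def ncword_def)
    then show ?thesis
      by (metis neg_equal_0_iff_equal zero_neq_one)
  next
    case (2 i j)
    then have "Poly_Mapping.lookup h [i, j] = 1"
      by (simp add: mult)
    then show ?thesis
      by (metis zero_neq_one)
  qed
  then obtain i j where "[i, j] \<in> Poly_Mapping.keys h"
    by (auto simp: in_keys_iff)
  then show ?thesis
    using enat_ncdeg_le_iff[of h "enat (ncdeg h)"] by force
qed

lemma H_graph_level:
  assumes "h \<in> H_graph V E" "enat (m + ncdeg h) \<le> d"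
  shows "enat m + 2 \<le> d"
proof -
  have "enat m + 2 \<le> enat (m + ncdeg h)"
    using ncdeg_H_graph[OF assms(1)] by (simp add: numeral_eq_enat)
  with assms(2) show ?thesis
    by (rule order_trans[rotated])
qed

lemma sum_in_H_col: "i \<in> V \<Longrightarrow> 1 - (\<Sum>c\<in>{1..k}. ncvar (i, c)) \<in> H_col V E k"
  unfolding H_col_def by blast

lemma product_in_H_col:
  assumes "i \<in> V" "j \<in> V" "c \<in> {1..k}" "c' \<in> {1..k}" "c \<noteq> c' \<and> i = j \<or> c = c' \<and> {i, j} \<in> E"
  shows "ncvar (i, c) * ncvar (j, c') \<in> H_col V E k"
  unfolding H_col_def using assms by blast

lemma sum_in_H_stab: "c \<in> {1..k} \<Longrightarrow> 1 - (\<Sum>i\<in>V. ncvar (c, i)) \<in> H_stab V E k"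
  unfolding H_stab_def by blast

lemma product_in_H_stab:
  assumes "i \<in> V" "j \<in> V" "c \<in> {1..k}" "c' \<in> {1..k}"
    "i \<noteq> j \<and> c = c' \<or> (i = j \<or> {i, j} \<in> E) \<and> c \<noteq> c'"
  shows "ncvar (c, i) * ncvar (c', j) \<in> H_stab V E k"
  unfolding H_stab_def using assms by blast

section \<open>Substitutions that respect the graph relations\<close>

text \<open>For a fixed colour \<open>c\<close>, idempotence at \<open>i\<close> comes from the
  family of all colours at \<open>i\<close>, and an edge is sent to a product with equal colours,
  which is itself a relation.\<close>

lemma admissible_col_pullback:
  assumes L: "admissible (V \<times> {1..k}) r (H_col V E k) L"
    and E: "\<And>e. e \<in> E \<Longrightarrow> e \<subseteq> V \<and> card e = 2"
    and c: "c \<in> {1..k}"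
  shows "admissible V r (H_graph V E) (\<lambda>p. L (ncsubst (\<lambda>i. ncvar (i, c)) p))"
proof (rule admissible_pullback[OF L])
  let ?Y = "V \<times> {1..k}"
  fix h q m
  assume h: "h \<in> H_graph V E" and q: "q \<in> ncpolys ?Y (enat m)"
    and "enat (m + ncdeg h) \<le> 2 * level_bound r"
  with H_graph_level have level: "enat m + 2 \<le> 2 * level_bound r"
    by blast
  from h consider (idem) i where "i \<in> V" "h = ncvar i - ncvar i ^ 2"
    | (edge) i j where "{i, j} \<in> E" "h = ncvar i * ncvar j"
    by (auto simp: H_graph_def)
  then show "L (q * ncsubst (\<lambda>i. ncvar (i, c)) h) = 0"
  proof cases
    case idem
    have "L (q * (ncvar (i, c) - ncvar (i, c) * ncvar (i, c))) = 0"
    proof (rule admissible_projection_relation[OF L _ _ _ _ _ q level])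
      show "1 - (\<Sum>b\<in>{i} \<times> {1..k}. ncvar b) \<in> H_col V E k"
        unfolding sum_singleton_Times by (rule sum_in_H_col[OF idem(1)])
      show "ncvar (i, c) * ncvar b \<in> H_col V E k" if "b \<in> {i} \<times> {1..k}" "b \<noteq> (i, c)" for b
        using that idem(1) c by (auto intro!: product_in_H_col)
    qed (use idem(1) c in auto)
    then show ?thesis
      using idem(2) by (simp add: ncsubst_diff power2_eq_square ncsubst_mult ncsubst_ncvar)
  next
    case edge
    with E have ij: "i \<in> V" "j \<in> V"
      by auto
    then have "ncvar (i, c) * ncvar (j, c) \<in> H_col V E k"
      using c edge(1) by (intro product_in_H_col) auto
    moreover have "q * (ncvar (i, c) * ncvar (j, c)) \<in> ncpolys ?Y (enat m + (1 + 1))"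
      using ij c by (intro mult_in_ncpolys q ncvar_in_ncpolys) auto
    then have "q * (ncvar (i, c) * ncvar (j, c)) \<in> ncpolys ?Y (2 * level_bound r)"
      by (rule ncpolys_mono) (use level in simp)
    ultimately have "L (q * (ncvar (i, c) * ncvar (j, c))) = 0"
      using admissible_ideal[OF L] ncpolys_unbounded[OF q] by blast
    then show ?thesis
      using edge(2) by (simp add: ncsubst_mult ncsubst_ncvar)
  qed
qed (use c in \<open>auto intro: ncvar_in_ncpolys simp: ncstar_ncvar\<close>)

text \<open>For fixed \<open>i\<close>, the variables indexed by \<open>(c, i)\<close> act as
  mutually orthogonal projections, so their sum acts as a projection. An edge is sent to a double
  sum of products each of which is a relation.\<close>

lemma admissible_stab_pullback:
  assumes L: "admissible ({1..k} \<times> V) r (H_stab V E k) L"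
    and "finite V"
    and E: "\<And>e. e \<in> E \<Longrightarrow> e \<subseteq> V \<and> card e = 2"
  shows "admissible V r (H_graph V E) (\<lambda>p. L (ncsubst (\<lambda>i. \<Sum>c\<in>{1..k}. ncvar (c, i)) p))"
proof (rule admissible_pullback[OF L])
  let ?Y = "{1..k} \<times> V" and ?d = "2 * level_bound r"
  have lin: "linear_functional ?Y ?d L"
    using L by (simp add: admissible_def)
  fix h q m
  assume h: "h \<in> H_graph V E" and q: "q \<in> ncpolys ?Y (enat m)"
    and "enat (m + ncdeg h) \<le> ?d"
  with H_graph_level have level: "enat m + 2 \<le> ?d"
    by blast
  have le: "f \<in> ncpolys ?Y 2 \<Longrightarrow> q * f \<in> ncpolys ?Y ?d" for f
    using mult_in_ncpolys[OF q] level by (blast intro: ncpolys_mono)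
  have var: "ncvar (c, i) \<in> ncpolys ?Y e" if "c \<in> {1..k}" "i \<in> V" "1 \<le> e" for c i e
    using that by (auto intro: ncvar_in_ncpolys)
  have var2: "ncvar (c, i) * ncvar (c', j) \<in> ncpolys ?Y 2"
    if "c \<in> {1..k}" "c' \<in> {1..k}" "i \<in> V" "j \<in> V" for c c' i j
    using mult_in_ncpolys[OF var[of c i 1] var[of c' j 1]] that by simp
  have zero: "L (q * (ncvar (c, i) * ncvar (c', j))) = 0"
    if "c \<in> {1..k}" "c' \<in> {1..k}" "i \<in> V" "j \<in> V"
      "i \<noteq> j \<and> c = c' \<or> (i = j \<or> {i, j} \<in> E) \<and> c \<noteq> c'" for c c' i j
  proof -
    have "ncvar (c, i) * ncvar (c', j) \<in> H_stab V E k"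
      using that by (intro product_in_H_stab)
    then show ?thesis
      using admissible_ideal[OF L] ncpolys_unbounded[OF q] le[OF var2] that by blast
  qed
  from h consider (idem) i where "i \<in> V" "h = ncvar i - ncvar i ^ 2"
    | (edge) i j where "{i, j} \<in> E" "h = ncvar i * ncvar j"
    by (auto simp: H_graph_def)
  then show "L (q * ncsubst (\<lambda>i. \<Sum>c\<in>{1..k}. ncvar (c, i)) h) = 0"
  proof cases
    case idem
    let ?y = "\<lambda>c. ncvar (c, i)"
    have diag: "L (q * (?y c - ?y c * ?y c)) = 0" if "c \<in> {1..k}" for c
    proof (rule admissible_projection_relation[OF L _ _ _ _ _ q level])
      show "1 - (\<Sum>b\<in>{c} \<times> V. ncvar b) \<in> H_stab V E k"
        unfolding sum_singleton_Times by (rule sum_in_H_stab[OF that])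
      show "ncvar (c, i) * ncvar b \<in> H_stab V E k" if "b \<in> {c} \<times> V" "b \<noteq> (c, i)" for b
        using that idem(1) \<open>c \<in> {1..k}\<close> by (auto intro!: product_in_H_stab)
    qed (use idem(1) that \<open>finite V\<close> in auto)
    \<comment> \<open>In the expanded square the diagonal terms are handled by \<open>diag\<close>;
      the others are relations of type \<open>i = j\<close> and
      \<open>c \<noteq> c'\<close>.\<close>
    have "(\<Sum>c\<in>{1..k}. ?y c) - (\<Sum>c\<in>{1..k}. ?y c) ^ 2
        = (\<Sum>c\<in>{1..k}. ?y c - (\<Sum>c'\<in>{1..k}. ?y c * ?y c'))"
      by (simp add: power2_eq_square sum_product sum_subtractf)
    also have "\<dots> = (\<Sum>c\<in>{1..k}. (?y c - ?y c * ?y c) - (\<Sum>c'\<in>{1..k} - {c}. ?y c * ?y c'))"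
      by (intro sum.cong refl) (simp add: sum.remove)
    finally have "q * ncsubst (\<lambda>i. \<Sum>c\<in>{1..k}. ncvar (c, i)) h
        = (\<Sum>c\<in>{1..k}. q * (?y c - ?y c * ?y c) - (\<Sum>c'\<in>{1..k} - {c}. q * (?y c * ?y c')))"
      by (simp add: idem(2) ncsubst_diff power2_eq_square ncsubst_mult ncsubst_ncvar
          sum_distrib_left right_diff_distrib)
    moreover have "q * (?y c - ?y c * ?y c) \<in> ncpolys ?Y ?d" if "c \<in> {1..k}" for c
      using that idem(1) by (intro le diff_in_ncpolys var2 var) (auto simp: numeral_eq_enat one_enat_def)
    moreover have "(\<Sum>c'\<in>{1..k} - {c}. q * (?y c * ?y c')) \<in> ncpolys ?Y ?d"
      if "c \<in> {1..k}" for c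
      using that idem(1) by (intro sum_in_ncpolys le var2) auto
    moreover have "L (\<Sum>c'\<in>{1..k} - {c}. q * (?y c * ?y c')) = 0" if "c \<in> {1..k}" for c
      using that idem(1) by (intro linear_sum_eq_0[OF lin] conjI le var2 zero) auto
    ultimately show ?thesis
      by (simp only:, intro linear_sum_eq_0[OF lin]) (simp add: diff_in_ncpolys linear_diff[OF lin] diag)
  next
    case edge
    \<comment> \<open>Edges have two elements, so \<open>i \<noteq> j\<close>: this makes the terms
      with \<open>c = c'\<close> relations, while adjacency covers
      \<open>c \<noteq> c'\<close>.\<close>
    have ij: "i \<in> V" "j \<in> V" "i \<noteq> j"
      using E[OF edge(1)] by (auto simp: card_insert_if split: if_splits)
    have "q * ncsubst (\<lambda>i. \<Sum>c\<in>{1..k}. ncvar (c, i)) h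
        = (\<Sum>c\<in>{1..k}. \<Sum>c'\<in>{1..k}. q * (ncvar (c, i) * ncvar (c', j)))"
      by (simp add: edge(2) ncsubst_mult ncsubst_ncvar sum_product) (simp add: sum_distrib_left)
    moreover have "L (q * (ncvar (c, i) * ncvar (c', j))) = 0" if "c \<in> {1..k}" "c' \<in> {1..k}" for c c'
      using ij edge(1) that by (intro zero) auto
    ultimately show ?thesis
      using ij by (simp only:, intro linear_sum_eq_0[OF lin] conjI sum_in_ncpolys le var2)
  qed
qed (auto intro!: sum_in_ncpolys ncvar_in_ncpolys simp: ncstar_ncvar ncstar_sum)

section \<open>Positive levels and the degenerate level 0\<close>

lemma level_bound_pos: "level_bound r \<noteq> 0 \<Longrightarrow> 2 \<le> 2 * level_bound r"
  by (cases "level_bound r") (auto simp: numeral_eq_enat zero_enat_def)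

text \<open>At level 0 all constraints concern constants, where \<open>L\<close> is a nonnegative
  multiple of the constant coefficient. Values of \<open>L\<close> on polynomials of positive degree
  remain free.\<close>

lemma admissible_level_0:
  assumes L: "\<And>p. p \<in> ncpolys UNIV 0 \<Longrightarrow> L p = a * Poly_Mapping.lookup p []" and "0 \<le> a"
    and H: "\<And>h. h \<in> H \<Longrightarrow> Poly_Mapping.lookup h [] = 0"
  shows "admissible X (Level 0) H L"
proof -
  have L_X: "L p = a * Poly_Mapping.lookup p []" if "p \<in> ncpolys X 0" for p
    using that by (intro L) (auto simp: ncpolys_iff)
  have star: "ncstar p * p \<in> ncpolys X 0" if "p \<in> ncpolys X 0" for p
    using mult_in_ncpolys[OF ncstar_in_ncpolys[OF that] that] by simp
  have "positive X 0 L"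
    using \<open>0 \<le> a\<close> by (simp add: positive_def L_X star lookup_mult_Nil lookup_ncstar)
  moreover have "linear_functional X 0 L"
    unfolding linear_functional_def
    by (auto simp: L_X add_in_ncpolys ncscale_in_ncpolys lookup_add lookup_ncscale_Nil algebra_simps)
  moreover have "L f = 0" if "f \<in> trunc_ideal X 0 H" for f
  proof -
    from that obtain p h where f: "f = p * h" "h \<in> H" "enat (ncdeg f) \<le> 0"
      by (auto simp: trunc_ideal_def)
    \<comment> \<open>The relations in \<open>H\<close> are not assumed to be polynomials in the
      variables \<open>X\<close>, hence \<open>UNIV\<close>.\<close>
    then have "f \<in> ncpolys UNIV 0"
      by (simp add: ncpolys_def)
    then show ?thesis
      using f H by (simp add: L lookup_mult_Nil)
  qed
  ultimately show ?thesis
    by (auto simp: admissible_def symmetric_def tracial_def zero_enat_def[symmetric] enat_0_iff)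
qed

lemma H_graph_constant_coefficient: "h \<in> H_graph V E \<Longrightarrow> Poly_Mapping.lookup h [] = 0"
  by (auto simp: H_graph_def lookup_minus power2_eq_square lookup_mult_Nil ncvar_def ncword_def lookup_single)

lemma ncvar_not_constant: "ncvar x \<notin> ncpolys X 0"
  by (simp add: ncpolys_iff ncvar_def ncword_def zero_enat_def)

lemma level_bound_eq_0: "level_bound r = 0 \<longleftrightarrow> r = Level 0"
  by (cases r) auto

section \<open>The colouring inequality\<close>

text \<open>Giving all vertices distinct colours is a proper colouring, and evaluation at its
  indicator is feasible. This makes the \<open>LEAST\<close> in \<open>gamma_col\<close>
  meaningful.\<close>

lemma ex_admissible_col:
  assumes "finite V" and E: "\<And>e. e \<in> E \<Longrightarrow> e \<subseteq> V \<and> card e = 2"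
  shows "\<exists>k L. admissible (V \<times> {1..k}) r (H_col V E k) L \<and> L 1 = 1"
proof -
  obtain f where f: "bij_betw f V {1..card V}"
    using ex_bij_betw_finite_nat[OF \<open>finite V\<close>] ex_bij_betw_nat_finite_1[OF \<open>finite V\<close>] bij_betw_inv by blast
  define L where "L = character (\<lambda>(i, c). of_bool (c = f i) :: real)"
  have "L h = 0" if "h \<in> H_col V E (card V)" for h
  proof -
    from that consider (sum) i where "i \<in> V" "h = 1 - (\<Sum>c\<in>{1..card V}. ncvar (i, c))"
      | (edge) i c j c' where "i \<in> V" "j \<in> V" "h = ncvar (i, c) * ncvar (j, c')"
          "c \<noteq> c' \<and> i = j \<or> c = c' \<and> {i, j} \<in> E"
      unfolding H_col_def by blast
    then show ?thesis
    proof cases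
      case sum
      have "f i \<in> {1..card V}"
        using f sum(1) by (auto simp: bij_betw_def)
      then show ?thesis
        by (simp add: L_def sum(2) character_simps of_bool_def)
    next
      case edge
      \<comment> \<open>An edge has two distinct ends, and \<open>f\<close> is injective.\<close>
      have "f i \<noteq> f j" if "{i, j} \<in> E"
        using E[OF that] f edge(1,2) by (auto simp: bij_betw_def inj_on_eq_iff)
      with edge(3,4) show ?thesis
        by (auto simp: L_def character_simps)
    qed
  qed
  then have "admissible (V \<times> {1..card V}) r (H_col V E (card V)) L"
    unfolding L_def by (rule admissible_character)
  moreover have "L 1 = 1"
    by (simp add: L_def character_simps)
  ultimately show ?thesis
    by blast
qed

lemma xi_col_le_gamma_col:
  assumes "finite V" and E: "\<And>e. e \<in> E \<Longrightarrow> e \<subseteq> V \<and> card e = 2"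
  shows "xi_col r V E \<le> ereal (real (gamma_col r V E))"
proof (cases "level_bound r = 0")
  case True
  \<comment> \<open>Values on variables are unconstrained at level 0, so the required value 1 there
    is compatible with value 0 on all constants; the infimum is then at most 0.\<close>
  let ?L = "\<lambda>p. of_bool (p \<in> range ncvar) :: real"
  have "admissible V r (H_graph V E) ?L"
    unfolding True[unfolded level_bound_eq_0]
    by (rule admissible_level_0[of _ 0]) (auto simp: ncvar_not_constant H_graph_constant_coefficient)
  moreover have "?L 1 = 0"
    using ncvar_not_constant one_in_ncpolys[of UNIV 0] by (metis of_bool_eq_0_iff rangeE)
  ultimately have "xi_col r V E \<le> ereal 0"
    unfolding xi_col_def by (intro Inf_lower CollectI exI[of _ ?L]) auto
  also have "\<dots> \<le> ereal (real (gamma_col r V E))"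
    by simp
  finally show ?thesis .
next
  case False
  then have d: "2 \<le> 2 * level_bound r"
    by (rule level_bound_pos)
  then have d1: "1 \<le> 2 * level_bound r"
    by (rule order_trans[rotated]) (simp add: one_enat_def numeral_eq_enat)
  define k where "k = gamma_col r V E"
  have "\<exists>L. admissible (V \<times> {1..k}) r (H_col V E k) L \<and> L 1 = 1"
    unfolding k_def gamma_col_def by (rule LeastI_ex) (rule ex_admissible_col[OF assms])
  then obtain L where L: "admissible (V \<times> {1..k}) r (H_col V E k) L" and L1: "L 1 = 1"
    by blast
  let ?Y = "V \<times> {1..k}" and ?d = "2 * level_bound r"
  have lin: "linear_functional ?Y ?d L"
    using L by (simp add: admissible_def)
  let ?L = "\<lambda>p. \<Sum>c\<in>{1..k}. L (ncsubst (\<lambda>i. ncvar (i, c)) p)"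
  have "admissible V r (H_graph V E) ?L"
    by (intro admissible_sum admissible_col_pullback[OF L E]) auto
  moreover have "?L (ncvar i) = 1" if "i \<in> V" for i
  proof -
    have var: "ncvar (i, c) \<in> ncpolys ?Y ?d" if "c \<in> {1..k}" for c
      using that \<open>i \<in> V\<close> d1 by (auto intro: ncvar_in_ncpolys)
    then have sum: "(\<Sum>c\<in>{1..k}. ncvar (i, c)) \<in> ncpolys ?Y ?d"
      by (rule sum_in_ncpolys)
    have "?L (ncvar i) = L (\<Sum>c\<in>{1..k}. ncvar (i, c))"
      using linear_sum[OF lin var, of "{1..k}"] by (simp add: ncsubst_ncvar)
    \<comment> \<open>The relation at vertex \<open>i\<close> with left multiplier 1: the values
      over all colours add up to \<open>L 1 = 1\<close>.\<close>
    moreover have "L (1 * (1 - (\<Sum>c\<in>{1..k}. ncvar (i, c)))) = 0"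
      using \<open>i \<in> V\<close> sum
      by (intro admissible_ideal[OF L sum_in_H_col]) (auto intro: one_in_ncpolys diff_in_ncpolys)
    ultimately show ?thesis
      by (simp add: linear_diff[OF lin one_in_ncpolys sum] L1 del: One_nat_def)
  qed
  moreover have "?L 1 = real k"
    by (simp add: ncsubst_1 L1)
  ultimately have "xi_col r V E \<le> ereal (real k)"
    unfolding xi_col_def by (intro Inf_lower CollectI exI[of _ ?L]) auto
  then show ?thesis
    by (simp add: k_def)
qed

section \<open>The stability inequality\<close>

text \<open>After exchanging the two sums, each of the \<open>k\<close> colours contributes
  \<open>L 1 = 1\<close>. At level 0 with \<open>V = {}\<close> the inner sums are the zero
  polynomial and so still lie in the space.\<close>

lemma admissible_stab_value:
  assumes L: "admissible ({1..k} \<times> V) r (H_stab V E k) L" and L1: "L 1 = 1"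
    and r: "level_bound r \<noteq> 0 \<or> V = {}"
  shows "L (ncsubst (\<lambda>i. \<Sum>c\<in>{1..k}. ncvar (c, i)) (\<Sum>i\<in>V. ncvar i)) = real k"
proof -
  let ?Y = "{1..k} \<times> V" and ?d = "2 * level_bound r"
  have lin: "linear_functional ?Y ?d L"
    using L by (simp add: admissible_def)
  have sum: "(\<Sum>i\<in>V. ncvar (c, i)) \<in> ncpolys ?Y ?d" if "c \<in> {1..k}" for c
  proof (rule sum_in_ncpolys)
    fix i assume "i \<in> V"
    with r have "2 \<le> ?d"
      using level_bound_pos by auto
    then have "1 \<le> ?d"
      by (rule order_trans[rotated]) (simp add: one_enat_def numeral_eq_enat)
    then show "ncvar (c, i) \<in> ncpolys ?Y ?d"
      using that \<open>i \<in> V\<close> by (auto intro: ncvar_in_ncpolys)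
  qed
  have "ncsubst (\<lambda>i. \<Sum>c\<in>{1..k}. ncvar (c, i)) (\<Sum>i\<in>V. ncvar i) = (\<Sum>c\<in>{1..k}. \<Sum>i\<in>V. ncvar (c, i))"
    by (simp add: ncsubst_sum ncsubst_ncvar) (rule sum.swap)
  moreover have "L (\<Sum>i\<in>V. ncvar (c, i)) = 1" if "c \<in> {1..k}" for c
  proof -
    have "L (1 * (1 - (\<Sum>i\<in>V. ncvar (c, i)))) = 0"
      using that sum
      by (intro admissible_ideal[OF L sum_in_H_stab]) (auto intro: one_in_ncpolys diff_in_ncpolys)
    then show ?thesis
      using that by (simp add: linear_diff[OF lin one_in_ncpolys sum] L1 del: One_nat_def)
  qed
  ultimately show ?thesis
    using linear_sum[OF lin sum, of "{1..k}"] by simp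
qed

text \<open>Positivity at \<open>1 - ncvar i\<close>, combined with idempotence, gives
  \<open>0 \<le> 1 - L (ncvar i)\<close>; summing over the vertices yields the bound.\<close>

lemma admissible_graph_value_le:
  assumes L: "admissible V r (H_graph V E) L" and L1: "L 1 = 1"
    and r: "level_bound r \<noteq> 0 \<or> V = {}"
  shows "L (\<Sum>i\<in>V. ncvar i) \<le> real (card V)"
proof (cases "V = {}")
  case True
  have "linear_functional V (2 * level_bound r) L"
    using L by (simp add: admissible_def)
  with True show ?thesis
    by (simp add: linear_0)
next
  case False
  with r have level: "1 \<le> level_bound r"
    by (cases "level_bound r") (auto simp: one_enat_def zero_enat_def)
  let ?d = "2 * level_bound r"
  have d: "1 + 1 \<le> ?d" "1 \<le> ?d"
    using add_mono[OF level level] order_trans[OF level, of ?d] by (simp_all add: mult_2)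
  have lin: "linear_functional V ?d L" and pos: "positive V (level_bound r) L"
    using L by (simp_all add: admissible_def)
  have "L (ncvar i) \<le> 1" if "i \<in> V" for i
  proof -
    have x: "ncvar i \<in> ncpolys V e" if "1 \<le> e" for e
      using that \<open>i \<in> V\<close> by (rule ncvar_in_ncpolys[rotated])
    have "ncvar i * ncvar i \<in> ncpolys V (1 + 1)"
      by (intro mult_in_ncpolys x) auto
    then have xx: "ncvar i * ncvar i \<in> ncpolys V ?d"
      by (rule ncpolys_mono[OF _ d(1)])
    have "L (1 * (ncvar i - ncvar i ^ 2)) = 0"
      using \<open>i \<in> V\<close> x[OF d(2)] xx
      by (intro admissible_ideal[OF L])
        (auto simp: H_graph_def power2_eq_square intro: one_in_ncpolys diff_in_ncpolys)
    then have idem: "L (ncvar i - ncvar i * ncvar i) = 0"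
      by (simp add: power2_eq_square)
    have "0 \<le> L (ncstar (1 - ncvar i) * (1 - ncvar i))"
      using pos diff_in_ncpolys[OF one_in_ncpolys x[OF level]] by (auto simp: positive_def)
    also have "ncstar (1 - ncvar i) * (1 - ncvar i) = 1 - ncvar i - (ncvar i - ncvar i * ncvar i)"
      by (simp add: ncstar_minus ncstar_one ncstar_ncvar algebra_simps)
    also have "L \<dots> = 1 - L (ncvar i)"
      using idem x[OF d(2)] xx
      by (simp add: linear_diff[OF lin] diff_in_ncpolys one_in_ncpolys L1)
    finally show ?thesis
      by simp
  qed
  then have "(\<Sum>i\<in>V. L (ncvar i)) \<le> real (card V) * 1"
    by (rule sum_bounded_above)
  then show ?thesis
    using d(2) by (simp add: linear_sum[OF lin] ncvar_in_ncpolys)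
qed

lemma xi_stab_ge_gamma_stab:
  assumes "finite V" and E: "\<And>e. e \<in> E \<Longrightarrow> e \<subseteq> V \<and> card e = 2"
  shows "ereal (real (gamma_stab r V E)) \<le> xi_stab r V E"
proof (cases "level_bound r \<noteq> 0 \<or> V = {}")
  case True
  let ?P = "\<lambda>k. \<exists>L. admissible ({1..k} \<times> V) r (H_stab V E k) L \<and> L 1 = 1"
  let ?s = "\<lambda>k i. \<Sum>c\<in>{1..k}. ncvar (c, i)"
  define k where "k = gamma_stab r V E"
  have "H_stab V E 0 = {}"
    by (auto simp: H_stab_def)
  \<comment> \<open>For \<open>k = 0\<close> there are no variables and no relations, so the
    constant coefficient is feasible.\<close>
  then have "?P 0"
    by (intro exI[of _ "\<lambda>p. Poly_Mapping.lookup p []"])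
      (simp add: admissible_constant_coefficient lookup_one zero_list_def)
  moreover have "k \<le> card V" if "?P k" for k
  proof -
    from that obtain L where L: "admissible ({1..k} \<times> V) r (H_stab V E k) L" "L 1 = 1"
      by blast
    \<comment> \<open>The left side equals \<open>k\<close>, so feasible values of \<open>k\<close>
      are bounded by \<open>card V\<close>.\<close>
    have "L (ncsubst (?s k) (\<Sum>i\<in>V. ncvar i)) \<le> real (card V)"
      using admissible_graph_value_le[OF admissible_stab_pullback[OF L(1) assms] _ True] L(2)
      by (simp add: ncsubst_1)
    then show ?thesis
      unfolding admissible_stab_value[OF L True] by simp
  qed
  \<comment> \<open>The set of feasible values is nonempty and bounded, so \<open>GREATEST\<close>
    is attained.\<close>
  ultimately have "?P k"
    unfolding k_def gamma_stab_def by (rule GreatestI_nat)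
  then obtain L where L: "admissible ({1..k} \<times> V) r (H_stab V E k) L" "L 1 = 1"
    by blast
  let ?L = "\<lambda>p. L (ncsubst (?s k) p)"
  have "admissible V r (H_graph V E) ?L"
    by (rule admissible_stab_pullback[OF L(1) assms])
  moreover have "?L 1 = 1"
    by (simp add: ncsubst_1 L(2))
  moreover have "?L (\<Sum>i\<in>V. ncvar i) = real k"
    by (rule admissible_stab_value[OF L True])
  ultimately have "ereal (real k) \<le> xi_stab r V E"
    unfolding xi_stab_def by (intro Sup_upper CollectI exI[of _ ?L]) auto
  then show ?thesis
    by (simp add: k_def)
next
  case False
  \<comment> \<open>Every \<open>k\<close> is feasible, so \<open>gamma_stab\<close> is an arbitrary number; but \<open>L\<close> is unconstrained on variables.\<close>
  then obtain j where "j \<in> V" and r: "r = Level 0"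
    by (auto simp: level_bound_eq_0)
  \<comment> \<open>The value on nonconstant polynomials is chosen to be exactly the number that the
    supremum must reach.\<close>
  let ?L = "\<lambda>p. if p \<in> ncpolys UNIV 0 then Poly_Mapping.lookup p [] else real (gamma_stab r V E)"
  have "admissible V r (H_graph V E) ?L"
    unfolding r by (rule admissible_level_0[of _ 1]) (auto simp: H_graph_constant_coefficient)
  moreover have "?L 1 = 1"
    by (simp add: one_in_ncpolys lookup_one zero_list_def)
  \<comment> \<open>The vertex \<open>j\<close> makes the sum nonconstant, so that \<open>?L\<close>
    takes the chosen value on it.\<close>
  moreover have "(\<Sum>i\<in>V. ncvar i) \<notin> ncpolys UNIV 0"
  proof -
    have "Poly_Mapping.lookup (\<Sum>i\<in>V. ncvar i) [j] = 1"
      using \<open>finite V\<close> \<open>j \<in> V\<close> by (simp add: lookup_sum ncvar_def ncword_def lookup_single when_def)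
    then have "[j] \<in> Poly_Mapping.keys (\<Sum>i\<in>V. ncvar i)"
      by (simp add: in_keys_iff)
    then show ?thesis
      by (auto simp: ncpolys_iff zero_enat_def)
  qed
  ultimately show ?thesis
    unfolding xi_stab_def by (intro Sup_upper CollectI exI[of _ ?L]) auto
qed

theorem proposition3p12:
  fixes V :: "'v set" and E :: "'v set set" and r :: level
  assumes "finite V"
    and "\<And>e. e \<in> E \<Longrightarrow> e \<subseteq> V \<and> card e = 2"
  shows "xi_col r V E \<le> ereal (real (gamma_col r V E)) \<and>
         xi_stab r V E \<ge> ereal (real (gamma_stab r V E))"
  using xi_col_le_gamma_col[OF assms] xi_stab_ge_gamma_stab[OF assms] by blast

end
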